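(* Let $P$ be a finite hereditary permutator and let $\sigma,\tau$ be types with conjunctive weak normal forms $cw(\sigma)=\bigwedge_{i\in I}\chi_i$ and $cw(\tau)=\bigwedge_{j\in J}\kappa_j$, where the $\chi_i,\kappa_j$ are basic unions. If $\vdash P:\sigma\to\tau$, then for every $j\in J$ there is $i_j\in I$ such that $\vdash P:\chi_{i_j}\to\kappa_j$.
   Context: Types: $\sigma ::= \varphi \mid \sigma\to\sigma \mid \sigma\wedge\sigma \mid \sigma\vee\sigma$ ($\varphi$ atomic). A basic type is an atomic or arrow type; basic intersections (resp. unions) are finite intersections (resp. unions) of basic types; at top level $\wedge,\vee$ are taken modulo associativity, commutativity, idempotence. Disjunctive weak normal form: $w(\alpha)=\alpha$ for atomic $\alpha$ and for arrows, $w(\sigma\vee\tau)=w(\sigma)\vee w(\tau)$, $w(\sigma\wedge\tau)=\bigvee_{i,j}(\mu_i\wedge\nu_j)$ if $w(\sigma)=\bigvee_i\mu_i$, $w(\tau)=\bigvee_j\nu_j$. Conjunctive weak normal form (obtained by applying $\sigma\to\tau\wedge\rho\mapsto(\sigma\to\tau)\wedge(\sigma\to\rho)$, $\sigma\vee\tau\to\rho\mapsto(\sigma\to\rho)\wedge(\tau\to\rho)$, $(\sigma\wedge\tau)\vee\rho\mapsto(\sigma\vee\rho)\wedge(\tau\vee\rho)$ at top level): $cw(\varphi)=\varphi$; $cw(\sigma\wedge\tau)=cw(\sigma)\wedge cw(\tau)$; if $cw(\sigma)=\bigwedge_i\chi_i$, $cw(\tau)=\bigwedge_j\kappa_j$ then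 $cw(\sigma\vee\tau)=\bigwedge_{i,j}(\chi_i\vee\kappa_j)$; if $w(\sigma)=\bigvee_k\mu_k$ and $cw(\tau)=\bigwedge_j\kappa_j$ then $cw(\sigma\to\tau)=\bigwedge_{k,j}(\mu_k\to\kappa_j)$. Typing of linear $\lambda$-terms (each variable occurs exactly once): (Ax) $x:\sigma\vdash x:\sigma$; ($\to$I) from $\Gamma,x:\sigma\vdash M:\tau$ infer $\Gamma\vdash\lambda x.M:\sigma\to\tau$; ($\to$E) from $\Gamma_1\vdash M:\sigma\to\tau$, $\Gamma_2\vdash N:\sigma$ infer $\Gamma_1,\Gamma_2\vdash MN:\tau$; ($\wedge$I) from $\Gamma\vdash M:\sigma$, $\Gamma\vdash M:\tau$ infer $\Gamma\vdash M:\sigma\wedge\tau$; ($\wedge$E) from $\Gamma\vdash M:\sigma\wedge\tau$ infer $\Gamma\vdash M:\sigma$ and $\Gamma\vdash M:\tau$; ($\vee$I) from $\Gamma\vdash M:\sigma$ infer $\Gamma\vdash M:\sigma\vee\tau$ and $\Gamma\vdash M:\tau\vee\sigma$; ($\vee$E) from $\Gamma_1,x:\sigma\wedge\theta\vdash M:\rho$, $\Gamma_1,x:\tau\wedge\theta\vdash M:\rho$, $\Gamma_2\vdash N:(\sigma\vee\tau)\wedge\theta$ infer $\Gamma_1,\Gamma_2\vdash M[N/x]:\rho$. Environments: finite sets of $x:\sigma$ with distinct variables; $\Gamma_1,\Gamma_2$ disjoint. A finite hereditary permutator is a $\lambda$-term which modulo $\beta$-conversion has the form $\lambda xy_1\dots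 y_n.x(P_1y_{\pi(1)})\dots(P_ny_{\pi(n)})$ ($n\ge0$), $\pi$ a permutation, $P_i$ finite hereditary permutators. *)

theory Defs
  imports "HOL-Combinatorics.Permutations"
begin

section \<open>Types and weak normal forms\<close>

datatype 'a ty =
    Atom 'a
  | Arrow "'a ty" "'a ty"  (infixr "\<^bold>\<rightarrow>" 60)
  | Inter "'a ty" "'a ty"  (infixr "\<^bold>\<and>" 70)
  | Union "'a ty" "'a ty"  (infixr "\<^bold>\<or>" 65)

fun basic :: "'a ty \<Rightarrow> bool" where
  "basic (Atom a) = True"
| "basic (\<sigma> \<^bold>\<rightarrow> \<tau>) = True"
| "basic _ = False"

fun basic_union :: "'a ty \<Rightarrow> bool" where
  "basic_union (\<sigma> \<^bold>\<or> \<tau>) = (basic_union \<sigma> \<and> basic_union \<tau>)"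
| "basic_union \<sigma> = basic \<sigma>"

text \<open>Associativity, commutativity and idempotence at top level: the relation is compatible
  with intersection and union, but not with the arrow.\<close>

inductive aci :: "'a ty \<Rightarrow> 'a ty \<Rightarrow> bool"  (infix "\<simeq>" 50) where
  refl: "\<sigma> \<simeq> \<sigma>"
| sym: "\<sigma> \<simeq> \<tau> \<Longrightarrow> \<tau> \<simeq> \<sigma>"
| trans: "\<sigma> \<simeq> \<tau> \<Longrightarrow> \<tau> \<simeq> \<rho> \<Longrightarrow> \<sigma> \<simeq> \<rho>"
| Inter_cong: "\<sigma> \<simeq> \<sigma>' \<Longrightarrow> \<tau> \<simeq> \<tau>' \<Longrightarrow> \<sigma> \<^bold>\<and> \<tau> \<simeq> \<sigma>' \<^bold>\<and> \<tau>'"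
| Inter_assoc: "(\<sigma> \<^bold>\<and> \<tau>) \<^bold>\<and> \<rho> \<simeq> \<sigma> \<^bold>\<and> (\<tau> \<^bold>\<and> \<rho>)"
| Inter_comm: "\<sigma> \<^bold>\<and> \<tau> \<simeq> \<tau> \<^bold>\<and> \<sigma>"
| Inter_idem: "\<sigma> \<^bold>\<and> \<sigma> \<simeq> \<sigma>"
| Union_cong: "\<sigma> \<simeq> \<sigma>' \<Longrightarrow> \<tau> \<simeq> \<tau>' \<Longrightarrow> \<sigma> \<^bold>\<or> \<tau> \<simeq> \<sigma>' \<^bold>\<or> \<tau>'"
| Union_assoc: "(\<sigma> \<^bold>\<or> \<tau>) \<^bold>\<or> \<rho> \<simeq> \<sigma> \<^bold>\<or> (\<tau> \<^bold>\<or> \<rho>)"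
| Union_comm: "\<sigma> \<^bold>\<or> \<tau> \<simeq> \<tau> \<^bold>\<or> \<sigma>"
| Union_idem: "\<sigma> \<^bold>\<or> \<sigma> \<simeq> \<sigma>"

text \<open>Intersections and unions of nonempty finite families; the value on the empty list
  is unspecified.\<close>

fun Inters :: "'a ty list \<Rightarrow> 'a ty" where
  "Inters [\<sigma>] = \<sigma>"
| "Inters (\<sigma> # \<tau> # \<rho>s) = \<sigma> \<^bold>\<and> Inters (\<tau> # \<rho>s)"

fun Unions :: "'a ty list \<Rightarrow> 'a ty" where
  "Unions [\<sigma>] = \<sigma>"
| "Unions (\<sigma> # \<tau> # \<rho>s) = \<sigma> \<^bold>\<or> Unions (\<tau> # \<rho>s)"

fun conjuncts :: "'a ty \<Rightarrow> 'a ty list" where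
  "conjuncts (\<sigma> \<^bold>\<and> \<tau>) = conjuncts \<sigma> @ conjuncts \<tau>"
| "conjuncts \<sigma> = [\<sigma>]"

fun disjuncts :: "'a ty \<Rightarrow> 'a ty list" where
  "disjuncts (\<sigma> \<^bold>\<or> \<tau>) = disjuncts \<sigma> @ disjuncts \<tau>"
| "disjuncts \<sigma> = [\<sigma>]"

text \<open>The type \<open>w \<sigma>\<close> is a union of basic intersections and \<open>cw \<sigma>\<close> is an intersection of basic
  unions. A basic intersection has no union and a basic union no intersection at top level, so
  \<open>disjuncts (w \<sigma>)\<close> and \<open>conjuncts (cw \<sigma>)\<close> recover the families of their components.\<close>

fun w :: "'a ty \<Rightarrow> 'a ty" where
  "w (Atom a) = Atom a"
| "w (\<sigma> \<^bold>\<rightarrow> \<tau>) = \<sigma> \<^bold>\<rightarrow> \<tau>"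
| "w (\<sigma> \<^bold>\<or> \<tau>) = w \<sigma> \<^bold>\<or> w \<tau>"
| "w (\<sigma> \<^bold>\<and> \<tau>) = Unions [\<mu> \<^bold>\<and> \<nu>. \<mu> \<leftarrow> disjuncts (w \<sigma>), \<nu> \<leftarrow> disjuncts (w \<tau>)]"

fun cw :: "'a ty \<Rightarrow> 'a ty" where
  "cw (Atom a) = Atom a"
| "cw (\<sigma> \<^bold>\<and> \<tau>) = cw \<sigma> \<^bold>\<and> cw \<tau>"
| "cw (\<sigma> \<^bold>\<or> \<tau>) = Inters [\<chi> \<^bold>\<or> \<kappa>. \<chi> \<leftarrow> conjuncts (cw \<sigma>), \<kappa> \<leftarrow> conjuncts (cw \<tau>)]"
| "cw (\<sigma> \<^bold>\<rightarrow> \<tau>) = Inters [\<mu> \<^bold>\<rightarrow> \<kappa>. \<mu> \<leftarrow> disjuncts (w \<sigma>), \<kappa> \<leftarrow> conjuncts (cw \<tau>)]"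

section \<open>Lambda-terms in de Bruijn notation\<close>

datatype trm = Var nat | App trm trm | Lam trm

primrec lift :: "trm \<Rightarrow> nat \<Rightarrow> trm" where
  "lift (Var i) k = (if i < k then Var i else Var (Suc i))"
| "lift (App M N) k = App (lift M k) (lift N k)"
| "lift (Lam M) k = Lam (lift M (Suc k))"

text \<open>Substitution removes the variable \<open>k\<close>: larger indices are decremented.\<close>

primrec subst :: "trm \<Rightarrow> trm \<Rightarrow> nat \<Rightarrow> trm"  ("_\<langle>_'/_\<rangle>" [300, 0, 0] 300) where
  "(Var i)\<langle>N/k\<rangle> = (if k < i then Var (i - 1) else if i = k then N else Var i)"
| "(App M M')\<langle>N/k\<rangle> = App (M\<langle>N/k\<rangle>) (M'\<langle>N/k\<rangle>)"
| "(Lam M)\<langle>N/k\<rangle> = Lam (M\<langle>lift N 0/Suc k\<rangle>)"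

inductive beta :: "trm \<Rightarrow> trm \<Rightarrow> bool"  (infixl "\<rightarrow>\<^sub>\<beta>" 50) where
  beta: "App (Lam M) N \<rightarrow>\<^sub>\<beta> M\<langle>N/0\<rangle>"
| appL: "M \<rightarrow>\<^sub>\<beta> M' \<Longrightarrow> App M N \<rightarrow>\<^sub>\<beta> App M' N"
| appR: "N \<rightarrow>\<^sub>\<beta> N' \<Longrightarrow> App M N \<rightarrow>\<^sub>\<beta> App M N'"
| lam: "M \<rightarrow>\<^sub>\<beta> M' \<Longrightarrow> Lam M \<rightarrow>\<^sub>\<beta> Lam M'"

abbreviation beta_conv :: "trm \<Rightarrow> trm \<Rightarrow> bool"  (infix "=\<^sub>\<beta>" 50) where
  "M =\<^sub>\<beta> N \<equiv> equivclp beta M N"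

text \<open>With \<open>y\<^sub>1, \<dots>, y\<^sub>n\<close> numbered from \<open>0\<close>, under the \<open>n + 1\<close> binders of
  \<open>\<lambda>x y\<^sub>0 \<dots> y\<^sub>n\<^sub>-\<^sub>1\<close> the variable \<open>x\<close> has index \<open>n\<close> and \<open>y\<^sub>i\<close> has index \<open>n - 1 - i\<close>. The terms
  \<open>Ps i\<close> are lifted over these binders, hence none of their variables is captured.\<close>

inductive fhp :: "trm \<Rightarrow> bool" where
  "\<lbrakk> \<pi> permutes {..<n};
     \<And>i. i < n \<Longrightarrow> fhp (Ps i);
     P =\<^sub>\<beta> (Lam ^^ Suc n) (foldl App (Var n)
           (map (\<lambda>i. App (((\<lambda>M. lift M 0) ^^ Suc n) (Ps i)) (Var (n - 1 - \<pi> i))) [0..<n])) \<rbrakk>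
   \<Longrightarrow> fhp P"

section \<open>Type assignment\<close>

type_synonym 'a env = "nat \<rightharpoonup> 'a ty"

text \<open>The environment \<open>\<Gamma>, x:\<sigma>\<close>, where \<open>x\<close> becomes the variable with index \<open>0\<close>.\<close>

definition env_extend :: "'a env \<Rightarrow> 'a ty \<Rightarrow> 'a env"  (infixl "\<lhd>" 60) where
  "\<Gamma> \<lhd> \<sigma> = case_nat (Some \<sigma>) \<Gamma>"

text \<open>Linearity and finiteness need no side conditions: whenever \<open>\<Gamma> \<turnstile> M \<Ztypecolon> \<sigma>\<close> is derivable,
  the domain of \<open>\<Gamma>\<close> is the set of free variables of \<open>M\<close>, and every free or bound variable of \<open>M\<close>
  occurs exactly once in its scope. In the rule of union elimination the variable \<open>x\<close> is, without
  loss of generality, the one with index \<open>0\<close>.\<close>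

inductive typing :: "'a env \<Rightarrow> trm \<Rightarrow> 'a ty \<Rightarrow> bool"  ("_ \<turnstile> _ \<Ztypecolon> _" [50, 50, 50] 50) where
  Ax: "[k \<mapsto> \<sigma>] \<turnstile> Var k \<Ztypecolon> \<sigma>"
| ArrowI: "\<Gamma> \<lhd> \<sigma> \<turnstile> M \<Ztypecolon> \<tau> \<Longrightarrow> \<Gamma> \<turnstile> Lam M \<Ztypecolon> \<sigma> \<^bold>\<rightarrow> \<tau>"
| ArrowE: "\<lbrakk> \<Gamma>\<^sub>1 \<turnstile> M \<Ztypecolon> \<sigma> \<^bold>\<rightarrow> \<tau>; \<Gamma>\<^sub>2 \<turnstile> N \<Ztypecolon> \<sigma>; dom \<Gamma>\<^sub>1 \<inter> dom \<Gamma>\<^sub>2 = {} \<rbrakk>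
    \<Longrightarrow> \<Gamma>\<^sub>1 ++ \<Gamma>\<^sub>2 \<turnstile> App M N \<Ztypecolon> \<tau>"
| InterI: "\<Gamma> \<turnstile> M \<Ztypecolon> \<sigma> \<Longrightarrow> \<Gamma> \<turnstile> M \<Ztypecolon> \<tau> \<Longrightarrow> \<Gamma> \<turnstile> M \<Ztypecolon> \<sigma> \<^bold>\<and> \<tau>"
| InterE1: "\<Gamma> \<turnstile> M \<Ztypecolon> \<sigma> \<^bold>\<and> \<tau> \<Longrightarrow> \<Gamma> \<turnstile> M \<Ztypecolon> \<sigma>"
| InterE2: "\<Gamma> \<turnstile> M \<Ztypecolon> \<sigma> \<^bold>\<and> \<tau> \<Longrightarrow> \<Gamma> \<turnstile> M \<Ztypecolon> \<tau>"
| UnionI1: "\<Gamma> \<turnstile> M \<Ztypecolon> \<sigma> \<Longrightarrow> \<Gamma> \<turnstile> M \<Ztypecolon> \<sigma> \<^bold>\<or> \<tau>"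
| UnionI2: "\<Gamma> \<turnstile> M \<Ztypecolon> \<sigma> \<Longrightarrow> \<Gamma> \<turnstile> M \<Ztypecolon> \<tau> \<^bold>\<or> \<sigma>"
| UnionE: "\<lbrakk> \<Gamma>\<^sub>1 \<lhd> \<sigma> \<^bold>\<and> \<theta> \<turnstile> M \<Ztypecolon> \<rho>; \<Gamma>\<^sub>1 \<lhd> \<tau> \<^bold>\<and> \<theta> \<turnstile> M \<Ztypecolon> \<rho>;
    \<Gamma>\<^sub>2 \<turnstile> N \<Ztypecolon> (\<sigma> \<^bold>\<or> \<tau>) \<^bold>\<and> \<theta>; dom \<Gamma>\<^sub>1 \<inter> dom \<Gamma>\<^sub>2 = {} \<rbrakk>
    \<Longrightarrow> \<Gamma>\<^sub>1 ++ \<Gamma>\<^sub>2 \<turnstile> M\<langle>N/0\<rangle> \<Ztypecolon> \<rho>"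

end

(* If P, applied to its abstracted variable x, reduces to a normal form x K1 ... Kp under some
   abstractions, where the arguments Ki have no non-captured application, then the types of P are
   governed by valuations, i.e. sets of basic types, of the single head x: the other subterms whose
   types union elimination could split have, over environments of basic intersections, a prime set of
   types. The valuation of all types for x that do not give the body a component kappa of cw tau
   would satisfy cw sigma if no component of cw sigma worked, and this is refuted by induction on the
   body, consuming one abstraction of the body or one argument of x at a time.

   P itself need not be normal, and types are not preserved by expansion below abstractions: with
   z : r -> (a -> d) | (b -> e) and y : r, the term \v. z y v has type (a -> d) | (b -> e), but
   \v. (\u. z u v) y has not. Therefore only redexes whose variables are not bound further out are
   contracted; for these both subject reduction and subject expansion hold, the latter because
   linearity makes the substitution lemma invertible. The shape of the normal form is still available
   by confluence. *)
theory Submission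
  imports Defs
begin

section \<open>Simultaneous substitution\<close>

text \<open>Modulo mutual \<open>\<sqsubseteq>\<close>, types form the free distributive lattice
  over the basic types: \<open>sat\<close> evaluates in it and \<open>\<sqsubseteq>\<close> is its
  order. On this lattice \<open>cw\<close> acts as a homomorphism, so a valuation can be pulled back
  along it (\<open>cw_core\<close>); this turns a statement about the components of
  \<open>cw \<sigma>\<close> into one about \<open>\<sigma>\<close>, whose form
  \<open>w \<sigma>\<close> then supplies a basic intersection. The obstacle is that an application
  \<open>z K\<close> can have a union type without having either member. Were \<open>z\<close> an
  arbitrary variable, the component to be chosen could depend on the branch of a union elimination
  on \<open>z K\<close>. If \<open>z\<close> is the head, the application is replaced by a new head
  variable, and a component for the new variable together with a basic intersection true of
  \<open>K\<close> yields an arrow that is a component for the old one. That \<open>z\<close> is the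
  head can be seen only in the normal form, which the induction therefore carries along with the
  term.\<close>

definition upr :: "(nat \<Rightarrow> nat) \<Rightarrow> nat \<Rightarrow> nat" where
  "upr f = case_nat 0 (\<lambda>i. Suc (f i))"

primrec ren :: "(nat \<Rightarrow> nat) \<Rightarrow> trm \<Rightarrow> trm" where
  "ren f (Var i) = Var (f i)"
| "ren f (App M N) = App (ren f M) (ren f N)"
| "ren f (Lam M) = Lam (ren (upr f) M)"

definition up :: "(nat \<Rightarrow> trm) \<Rightarrow> nat \<Rightarrow> trm" where
  "up s = case_nat (Var 0) (\<lambda>i. ren Suc (s i))"

primrec sub :: "(nat \<Rightarrow> trm) \<Rightarrow> trm \<Rightarrow> trm" where
  "sub s (Var i) = s i"
| "sub s (App M N) = App (sub s M) (sub s N)"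
| "sub s (Lam M) = Lam (sub (up s) M)"

abbreviation inst :: "trm \<Rightarrow> trm \<Rightarrow> trm" where
  "inst M N \<equiv> sub (case_nat N Var) M"

primrec occ :: "nat \<Rightarrow> trm \<Rightarrow> nat" where
  "occ k (Var i) = (if i = k then 1 else 0)"
| "occ k (App M N) = occ k M + occ k N"
| "occ k (Lam M) = occ (Suc k) M"

lemma upr_simps [simp]: "upr f 0 = 0" "upr f (Suc i) = Suc (f i)"
  by (simp_all add: upr_def)

lemma up_simps [simp]: "up s 0 = Var 0" "up s (Suc i) = ren Suc (s i)"
  by (simp_all add: up_def)

lemma upr_comp: "upr f \<circ> upr g = upr (f \<circ> g)"
  by (rule ext) (simp add: upr_def split: nat.split)

lemma up_Var: "up (\<lambda>i. Var (f i)) = (\<lambda>i. Var (upr f i))"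
  by (rule ext) (simp add: up_def upr_def split: nat.split)

lemma ren_sub: "ren f M = sub (\<lambda>i. Var (f i)) M"
  by (induction M arbitrary: f) (simp_all add: up_Var)

lemma ren_ren: "ren f (ren g M) = ren (f \<circ> g) M"
  by (induction M arbitrary: f g) (simp_all add: upr_comp)

lemma up_comp_upr: "up s \<circ> upr g = up (s \<circ> g)"
  by (rule ext) (simp add: up_def upr_def split: nat.split)

lemma sub_ren: "sub s (ren g M) = sub (s \<circ> g) M"
  by (induction M arbitrary: s g) (simp_all add: up_comp_upr)

lemma ren_up: "(\<lambda>i. ren (upr f) (up s i)) = up (\<lambda>i. ren f (s i))"
proof
  fix i show "ren (upr f) (up s i) = up (\<lambda>i. ren f (s i)) i"
    by (cases i) (simp_all add: ren_ren comp_def)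
qed

lemma ren_sub_comp: "ren f (sub s M) = sub (\<lambda>i. ren f (s i)) M"
  by (induction M arbitrary: s f) (simp_all add: ren_up)

lemma sub_up: "(\<lambda>i. sub (up t) (up s i)) = up (\<lambda>i. sub t (s i))"
proof
  fix i show "sub (up t) (up s i) = up (\<lambda>i. sub t (s i)) i"
    by (cases i) (simp_all add: sub_ren ren_sub_comp comp_def)
qed

lemma sub_sub: "sub t (sub s M) = sub (\<lambda>i. sub t (s i)) M"
  by (induction M arbitrary: s t) (simp_all add: sub_up)

lemma sub_cong: "(\<And>i. occ i M > 0 \<Longrightarrow> s i = t i) \<Longrightarrow> sub s M = sub t M"
proof (induction M arbitrary: s t)
  case (Var i)
  then show ?case by simp
next
  case (App M N)
  have "sub s M = sub t M" by (rule App.IH(1), rule App.prems) simp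
  moreover have "sub s N = sub t N" by (rule App.IH(2), rule App.prems) simp
  ultimately show ?case by simp
next
  case (Lam M)
  have "sub (up s) M = sub (up t) M"
  proof (rule Lam.IH)
    fix i assume i: "occ i M > 0"
    show "up s i = up t i"
    proof (cases i)
      case (Suc j)
      then have "s j = t j" using i by (intro Lam.prems) simp
      then show ?thesis using Suc by simp
    qed simp
  qed
  then show ?case by simp
qed

lemma up_id: "up Var = Var"
  by (rule ext) (simp add: up_def split: nat.split)

lemma sub_Var [simp]: "sub Var M = M"
  by (induction M) (simp_all add: up_id)

lemma sub_id: "(\<And>i. occ i M > 0 \<Longrightarrow> s i = Var i) \<Longrightarrow> sub s M = M"
  using sub_cong[of M s Var] by simp

lemma ren_id: "(\<And>i. occ i M > 0 \<Longrightarrow> f i = i) \<Longrightarrow> ren f M = M"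
  unfolding ren_sub by (rule sub_id) simp

lemma sub_case_nat: "(\<lambda>i. sub s (case_nat N t i)) = case_nat (sub s N) (\<lambda>i. sub s (t i))"
  by (rule ext) (simp split: nat.split)

lemma sub_inst: "sub s (inst M N) = sub (case_nat (sub s N) s) M"
  by (simp add: sub_sub sub_case_nat)

lemma inst_up: "inst (sub (up s) M) N = sub (case_nat N s) M"
proof -
  have "(\<lambda>i. inst (up s i) N) = case_nat N s"
  proof
    fix i show "inst (up s i) N = case_nat N s i"
      by (cases i) (simp_all add: sub_ren comp_def)
  qed
  then show ?thesis by (simp add: sub_sub)
qed

lemma sub_inst_up: "sub s (inst M N) = inst (sub (up s) M) (sub s N)"
  by (simp add: sub_inst inst_up)

lemma inst_ren_Suc [simp]: "inst (ren Suc M) N = M"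
  by (simp add: sub_ren comp_def)

lemma ren_inst: "ren f (inst M N) = inst (ren (upr f) M) (ren f N)"
  by (simp add: ren_sub sub_inst_up up_Var)

lemma lift_ren: "lift M k = ren (\<lambda>i. if i < k then i else Suc i) M"
proof (induction M arbitrary: k)
  case (Lam M)
  have "(\<lambda>i. if i < Suc k then i else Suc i) = upr (\<lambda>i. if i < k then i else Suc i)"
    by (rule ext) (simp add: upr_def split: nat.split)
  then show ?case by (simp add: Lam)
qed auto

lemma lift_0: "lift M 0 = ren Suc M"
  by (simp add: lift_ren)

lemma subst_sub: "subst M N k = sub (\<lambda>i. if k < i then Var (i - 1) else if i = k then N else Var i) M"
proof (induction M arbitrary: N k)
  case (Lam M)
  have "(\<lambda>i. if Suc k < i then Var (i - 1) else if i = Suc k then ren Suc N else Var i)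
      = up (\<lambda>i. if k < i then Var (i - 1) else if i = k then N else Var i)"
    by (rule ext) (auto simp: up_def gr0_conv_Suc split: nat.split)
  then show ?case by (simp add: Lam lift_0)
qed auto

lemma subst_inst: "subst M N 0 = inst M N"
proof -
  have "(\<lambda>i. if 0 < i then Var (i - 1) else if i = 0 then N else Var i) = case_nat N Var"
    by (rule ext) (simp split: nat.split)
  then show ?thesis by (simp add: subst_sub)
qed

section \<open>Occurrence counts and sizes under substitution\<close>

lemma occ_ren_inj: "inj f \<Longrightarrow> occ (f k) (ren f M) = occ k M"
proof (induction M arbitrary: f k)
  case (Var i)
  then show ?case by (auto dest: injD)
next
  case (Lam M)
  have "inj (upr f)"
  proof (rule injI)
    fix x y assume "upr f x = upr f y"
    then show "x = y" using Lam.prems by (cases x; cases y) (auto dest: injD)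
  qed
  from Lam.IH[OF this, of "Suc k"] show ?case by simp
next
  case (App M N)
  show ?case using App.IH(1)[OF App.prems, of k] App.IH(2)[OF App.prems, of k] by simp
qed

text \<open>Two source variables cover instantiation, where occurrences of \<open>k\<close> come
  from \<open>Suc k\<close> with weight 1 and from \<open>0\<close> with weight
  \<open>occ k N\<close>.\<close>

lemma occ_sub:
  assumes "j \<noteq> j'" and "\<And>i. occ k (s i) = (if i = j then m else if i = j' then m' else 0)"
  shows "occ k (sub s M) = m * occ j M + m' * occ j' M"
  using assms
proof (induction M arbitrary: s j j' k)
  case (Var i)
  then show ?case by simp
next
  case (App M N)
  show ?case
    using App.IH(1)[OF App.prems] App.IH(2)[OF App.prems] by (simp add: algebra_simps)
next
  case (Lam M)
  have "occ (Suc k) (up s i) = (if i = Suc j then m else if i = Suc j' then m' else 0)" for i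
    using Lam.prems(2) by (cases i) (simp_all add: occ_ren_inj[of Suc k, simplified])
  from Lam.IH[OF _ this] Lam.prems(1) show ?case by simp
qed

lemma occ_sub1:
  assumes "\<And>i. occ k (s i) = (if i = j then m else 0)"
  shows "occ k (sub s M) = m * occ j M"
proof -
  have "occ k (sub s M) = m * occ j M + 0 * occ (Suc j) M"
    by (rule occ_sub) (use assms in simp_all)
  then show ?thesis by simp
qed

lemma occ_sub_0: "(\<And>i. occ k (s i) = 0) \<Longrightarrow> occ k (sub s M) = 0"
  using occ_sub1[of k s 0 0 M] by simp

lemma occ_inst: "occ k (inst M N) = occ (Suc k) M + occ 0 M * occ k N"
  using occ_sub[of "Suc k" 0 k "case_nat N Var" 1 "occ k N" M]
  by (simp add: algebra_simps split: nat.split)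

lemma occ_ren_Suc [simp]: "occ 0 (ren Suc M) = 0" "occ (Suc k) (ren Suc M) = occ k M"
  using occ_sub_0[of 0 "\<lambda>i. Var (Suc i)" M] occ_sub1[of "Suc k" "\<lambda>i. Var (Suc i)" k 1 M]
  by (simp_all add: ren_sub)

lemma occ_up_0 [simp]: "occ 0 (sub (up s) M) = occ 0 M"
  using occ_sub1[of 0 "up s" 0 1 M] by (simp add: up_def split: nat.split)

lemma occ_upr_0 [simp]: "occ 0 (ren (upr f) M) = occ 0 M"
  using occ_up_0[of "\<lambda>i. Var (f i)" M] by (simp add: ren_sub up_Var)

lemma size_ren [simp]: "size (ren f M) = size M"
  by (induction M arbitrary: f) auto

lemma size_sub1:
  "(\<And>i. size (s i) = (if i = j then m else 0)) \<Longrightarrow> size (sub s M) = size M + occ j M * m"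
proof (induction M arbitrary: s j)
  case (App M N)
  show ?case using App.IH(1)[OF App.prems] App.IH(2)[OF App.prems] by (simp add: algebra_simps)
next
  case (Lam M)
  have "size (up s i) = (if i = Suc j then m else 0)" for i
    using Lam.prems by (cases i) simp_all
  from Lam.IH[OF this] show ?case by simp
qed simp

lemma size_inst: "size (inst M N) = size M + occ 0 M * size N"
  by (rule size_sub1) (simp split: nat.split)

section \<open>Non-captured applications\<close>

text \<open>Instantiation does not capture variables, so \<open>nca M\<close> says that some application subterm of
  \<open>M\<close> has no variable bound in \<open>M\<close>. Union elimination can split the types of such subterms only.\<close>

definition nca :: "trm \<Rightarrow> bool" where
  "nca M \<longleftrightarrow> (\<exists>M0 F K. occ 0 M0 = 1 \<and> M = inst M0 (App F K))"

lemma nca_App: "nca (App F K)"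
  unfolding nca_def by (intro exI[of _ "Var 0"] exI[of _ F] exI[of _ K]) simp

lemma nca_sub: "nca M \<Longrightarrow> nca (sub s M)"
  unfolding nca_def by (auto simp: sub_inst_up simp del: sub.simps)
    (metis occ_up_0 sub.simps(2))

text \<open>Composition of contexts whose hole is index \<open>0\<close>: the outer variables sit at
  \<open>Suc i\<close> in both \<open>K\<close> and \<open>M\<close>, and the hole of
  \<open>M\<close> becomes the hole of the result.\<close>

definition nest :: "trm \<Rightarrow> trm \<Rightarrow> trm" where
  "nest K M = sub (case_nat M (\<lambda>i. Var (Suc i))) K"

lemma inst_nest: "inst (nest K M) N = inst K (inst M N)"
proof -
  have "(\<lambda>i. inst (case_nat M (\<lambda>i. Var (Suc i)) i) N) = case_nat (inst M N) Var"
    by (rule ext) (simp split: nat.split)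
  then show ?thesis unfolding nest_def by (simp add: sub_sub)
qed

lemma occ_nest: "occ 0 (nest K M) = occ 0 K * occ 0 M"
  using occ_sub1[of 0 "case_nat M (\<lambda>i. Var (Suc i))" 0 "occ 0 M" K]
  unfolding nest_def by (simp split: nat.split)

lemma nca_inst: "occ 0 K = 1 \<Longrightarrow> nca N \<Longrightarrow> nca (inst K N)"
  unfolding nca_def by (metis inst_nest occ_nest mult_1)

text \<open>While \<open>F\<close> or \<open>K\<close> has a non-captured application, the hole
  moves down to it and the size drops. In the end \<open>F\<close> is a variable or an abstraction,
  since an application would itself be non-captured; this is the case split of the main
  induction.\<close>

lemma nca_minimal:
  assumes "nca M"
  obtains M0 F K where "occ 0 M0 = 1" "M = inst M0 (App F K)" "\<not> nca F" "\<not> nca K"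
proof -
  have "\<exists>M0 F K. occ 0 M0 = 1 \<and> M = inst M0 (App F K) \<and> \<not> nca F \<and> \<not> nca K"
    if "occ 0 M0 = 1" "M = inst M0 (App F K)" for M0 F K
    using that
  proof (induction "size (App F K)" arbitrary: M0 F K rule: less_induct)
    case less
    consider "nca F" | "nca K" | "\<not> nca F" "\<not> nca K" by blast
    then show ?case
    proof cases
      case 1
      then obtain F0 F' K' where F: "occ 0 F0 = 1" "F = inst F0 (App F' K')"
        unfolding nca_def by blast
      let ?M0 = "nest M0 (App F0 (ren Suc K))"
      show ?thesis
        by (rule less.hyps[of F' K' ?M0])
          (use less.prems F in \<open>auto simp: occ_nest inst_nest size_inst simp del: sub.simps(2) ren.simps(2)\<close>, simp)
    next
      case 2
      then obtain F0 F' K' where F: "occ 0 F0 = 1" "K = inst F0 (App F' K')"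
        unfolding nca_def by blast
      let ?M0 = "nest M0 (App (ren Suc F) F0)"
      show ?thesis
        by (rule less.hyps[of F' K' ?M0])
          (use less.prems F in \<open>auto simp: occ_nest inst_nest size_inst simp del: sub.simps(2) ren.simps(2)\<close>, simp)
    qed (use less.prems in blast)
  qed
  with assms that show ?thesis unfolding nca_def by blast
qed

section \<open>Valuations and weak normal forms\<close>

fun sat :: "'a ty set \<Rightarrow> 'a ty \<Rightarrow> bool" where
  "sat S (\<sigma> \<^bold>\<and> \<tau>) = (sat S \<sigma> \<and> sat S \<tau>)"
| "sat S (\<sigma> \<^bold>\<or> \<tau>) = (sat S \<sigma> \<or> sat S \<tau>)"
| "sat S \<sigma> = (\<sigma> \<in> S)"

definition entails :: "'a ty \<Rightarrow> 'a ty \<Rightarrow> bool"  (infix "\<sqsubseteq>" 50) where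
  "\<sigma> \<sqsubseteq> \<tau> \<longleftrightarrow> (\<forall>S. sat S \<sigma> \<longrightarrow> sat S \<tau>)"

fun binter :: "'a ty \<Rightarrow> bool" where
  "binter (\<sigma> \<^bold>\<and> \<tau>) = (binter \<sigma> \<and> binter \<tau>)"
| "binter \<sigma> = basic \<sigma>"

abbreviation conj_set :: "'a ty \<Rightarrow> 'a ty set" where
  "conj_set \<sigma> \<equiv> set (conjuncts \<sigma>)"

abbreviation disj_set :: "'a ty \<Rightarrow> 'a ty set" where
  "disj_set \<sigma> \<equiv> set (disjuncts \<sigma>)"

lemma sat_mono: "sat S \<sigma> \<Longrightarrow> S \<subseteq> S' \<Longrightarrow> sat S' \<sigma>"
  by (induction \<sigma>) auto

lemma sat_basic: "basic \<sigma> \<Longrightarrow> sat S \<sigma> \<longleftrightarrow> \<sigma> \<in> S"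
  by (cases \<sigma>) auto

lemma sat_conj_set: "sat S \<sigma> \<longleftrightarrow> (\<forall>\<tau>\<in>conj_set \<sigma>. sat S \<tau>)"
  by (induction \<sigma>) auto

lemma sat_disj_set: "sat S \<sigma> \<longleftrightarrow> (\<exists>\<tau>\<in>disj_set \<sigma>. sat S \<tau>)"
  by (induction \<sigma>) auto

lemma binter_conj_set: "binter \<sigma> \<Longrightarrow> \<tau> \<in> conj_set \<sigma> \<Longrightarrow> basic \<tau>"
  by (induction \<sigma>) auto

lemma basic_union_disj_set: "basic_union \<sigma> \<Longrightarrow> \<tau> \<in> disj_set \<sigma> \<Longrightarrow> basic \<tau>"
  by (induction \<sigma>) auto

lemma sat_binter: "binter \<sigma> \<Longrightarrow> sat S \<sigma> \<longleftrightarrow> conj_set \<sigma> \<subseteq> S"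
  by (induction \<sigma>) auto

lemma sat_basic_union: "basic_union \<sigma> \<Longrightarrow> sat S \<sigma> \<longleftrightarrow> disj_set \<sigma> \<inter> S \<noteq> {}"
  by (induction \<sigma>) auto

lemma disjuncts_Unions: "xs \<noteq> [] \<Longrightarrow> disjuncts (Unions xs) = concat (map disjuncts xs)"
  by (induction xs rule: Unions.induct) auto

lemma conjuncts_Inters: "xs \<noteq> [] \<Longrightarrow> conjuncts (Inters xs) = concat (map conjuncts xs)"
  by (induction xs rule: Inters.induct) auto

lemma sat_Inters: "xs \<noteq> [] \<Longrightarrow> sat S (Inters xs) \<longleftrightarrow> (\<forall>\<sigma>\<in>set xs. sat S \<sigma>)"
  by (induction xs rule: Inters.induct) auto

lemma disjuncts_nonempty [simp]: "disjuncts \<sigma> \<noteq> []"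
  by (induction \<sigma>) auto

lemma conjuncts_nonempty [simp]: "conjuncts \<sigma> \<noteq> []"
  by (induction \<sigma>) auto

lemma w_binter: "\<mu> \<in> disj_set (w \<sigma>) \<Longrightarrow> binter \<mu>"
proof (induction \<sigma> arbitrary: \<mu>)
  case (Inter \<sigma> \<tau>)
  then show ?case by (subst (asm) w.simps, subst (asm) disjuncts_Unions) auto
qed auto

lemma disj_set_w_Inter:
  "disj_set (w (\<sigma> \<^bold>\<and> \<tau>)) = {\<mu> \<^bold>\<and> \<nu> |\<mu> \<nu>. \<mu> \<in> disj_set (w \<sigma>) \<and> \<nu> \<in> disj_set (w \<tau>)}"
  by (subst w.simps, subst disjuncts_Unions) auto

lemma sat_w: "sat S \<sigma> \<longleftrightarrow> (\<exists>\<mu>\<in>disj_set (w \<sigma>). sat S \<mu>)"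
proof (induction \<sigma>)
  case (Inter \<sigma> \<tau>)
  then show ?case unfolding disj_set_w_Inter by fastforce
qed auto

lemma cw_basic_union: "\<chi> \<in> conj_set (cw \<sigma>) \<Longrightarrow> basic_union \<chi>"
proof (induction \<sigma> arbitrary: \<chi>)
  case (Union \<sigma> \<tau>)
  then show ?case by (subst (asm) cw.simps, subst (asm) conjuncts_Inters) auto
next
  case (Arrow \<sigma> \<tau>)
  then show ?case by (subst (asm) cw.simps, subst (asm) conjuncts_Inters) auto
qed auto

lemma conj_set_cw_Arrow:
  "conj_set (cw (\<sigma> \<^bold>\<rightarrow> \<tau>)) = {\<mu> \<^bold>\<rightarrow> \<kappa> |\<mu> \<kappa>. \<mu> \<in> disj_set (w \<sigma>) \<and> \<kappa> \<in> conj_set (cw \<tau>)}"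
  by (subst cw.simps, subst conjuncts_Inters) auto

lemma conj_set_cw_Union:
  "conj_set (cw (\<sigma> \<^bold>\<or> \<tau>)) = {\<chi> \<^bold>\<or> \<kappa> |\<chi> \<kappa>. \<chi> \<in> conj_set (cw \<sigma>) \<and> \<kappa> \<in> conj_set (cw \<tau>)}"
  by (subst cw.simps, subst conjuncts_Inters) auto

lemma cw_basic: "basic \<sigma> \<Longrightarrow> \<chi> \<in> conj_set (cw \<sigma>) \<Longrightarrow> basic \<chi>"
  by (cases \<sigma>) (auto simp: conj_set_cw_Arrow simp del: cw.simps(4))

text \<open>The pullback of the valuation \<open>S\<close> along \<open>cw\<close>, given on the
  generators; \<open>sat_cw\<close> extends it to all types.\<close>

definition cw_core :: "'a ty set \<Rightarrow> 'a ty set" where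
  "cw_core S = {\<sigma>. basic \<sigma> \<and> sat S (cw \<sigma>)}"

lemma sat_cw: "sat S (cw \<sigma>) \<longleftrightarrow> sat (cw_core S) \<sigma>"
proof (induction \<sigma>)
  case (Union \<sigma> \<tau>)
  have "sat S (cw (\<sigma> \<^bold>\<or> \<tau>)) \<longleftrightarrow> sat S (cw \<sigma>) \<or> sat S (cw \<tau>)"
    unfolding sat_conj_set[of S "cw (\<sigma> \<^bold>\<or> \<tau>)"] sat_conj_set[of S "cw \<sigma>"]
      sat_conj_set[of S "cw \<tau>"] conj_set_cw_Union
    by fastforce
  with Union show ?case by simp
qed (simp_all add: cw_core_def del: cw.simps(4))

lemma conj_set_cw_binter:
  "binter \<sigma> \<Longrightarrow> conj_set (cw \<sigma>) = (\<Union>\<tau>\<in>conj_set \<sigma>. conj_set (cw \<tau>))"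
  by (induction \<sigma>) auto

lemma conj_set_cw_Inters:
  "xs \<noteq> [] \<Longrightarrow> conj_set (cw (Inters xs)) = (\<Union>\<tau>\<in>set xs. conj_set (cw \<tau>))"
  by (induction xs rule: Inters.induct) auto

lemma aci_sat: "\<sigma> \<simeq> \<tau> \<Longrightarrow> sat S \<sigma> \<longleftrightarrow> sat S \<tau>"
  by (induction rule: aci.induct) auto

lemma entails_refl [simp]: "\<sigma> \<sqsubseteq> \<sigma>"
  by (simp add: entails_def)

lemma entails_trans: "\<sigma> \<sqsubseteq> \<tau> \<Longrightarrow> \<tau> \<sqsubseteq> \<rho> \<Longrightarrow> \<sigma> \<sqsubseteq> \<rho>"
  by (simp add: entails_def)

text \<open>In a free distributive lattice, an intersection lies below a union of generators only if
  one of its members does: otherwise the union of the separating valuations refutes it.\<close>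

lemma Inters_entails_basic_union:
  assumes "basic_union \<kappa>" and "xs \<noteq> []" and "Inters xs \<sqsubseteq> \<kappa>"
  obtains \<chi> where "\<chi> \<in> set xs" "\<chi> \<sqsubseteq> \<kappa>"
proof -
  have "\<exists>\<chi>\<in>set xs. \<chi> \<sqsubseteq> \<kappa>"
  proof (rule ccontr)
    assume "\<not> ?thesis"
    then have "\<forall>\<chi>\<in>set xs. \<exists>S. sat S \<chi> \<and> \<not> sat S \<kappa>" by (simp add: entails_def)
    then obtain S where S: "\<forall>\<chi>\<in>set xs. sat (S \<chi>) \<chi> \<and> \<not> sat (S \<chi>) \<kappa>" by metis
    have "sat (\<Union>\<chi>\<in>set xs. S \<chi>) \<chi>" if "\<chi> \<in> set xs" for \<chi>
      using S that sat_mono[of "S \<chi>" \<chi>] by blast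
    then have "sat (\<Union>\<chi>\<in>set xs. S \<chi>) \<kappa>"
      using assms(2,3) by (simp add: entails_def sat_Inters)
    then show False using S assms(1) by (auto simp: sat_basic_union)
  qed
  with that show thesis by blast
qed

section \<open>Type assignment with total environments\<close>

text \<open>For linear terms the splitting of environments is determined by the free variables, hence it
  can be dropped; of linearity only the condition on union elimination has to be kept.\<close>

abbreviation ext :: "(nat \<Rightarrow> 'a ty) \<Rightarrow> 'a ty \<Rightarrow> nat \<Rightarrow> 'a ty"  (infixl "\<triangleright>" 60) where
  "G \<triangleright> \<sigma> \<equiv> case_nat \<sigma> G"

inductive tp :: "(nat \<Rightarrow> 'a ty) \<Rightarrow> trm \<Rightarrow> 'a ty \<Rightarrow> bool"  ("_ \<tturnstile> _ \<Ztypecolon> _" [50, 50, 50] 50) where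
  Ax: "G \<tturnstile> Var k \<Ztypecolon> G k"
| ArrowI: "G \<triangleright> \<sigma> \<tturnstile> M \<Ztypecolon> \<tau> \<Longrightarrow> G \<tturnstile> Lam M \<Ztypecolon> \<sigma> \<^bold>\<rightarrow> \<tau>"
| ArrowE: "G \<tturnstile> M \<Ztypecolon> \<sigma> \<^bold>\<rightarrow> \<tau> \<Longrightarrow> G \<tturnstile> N \<Ztypecolon> \<sigma> \<Longrightarrow> G \<tturnstile> App M N \<Ztypecolon> \<tau>"
| InterI: "G \<tturnstile> M \<Ztypecolon> \<sigma> \<Longrightarrow> G \<tturnstile> M \<Ztypecolon> \<tau> \<Longrightarrow> G \<tturnstile> M \<Ztypecolon> \<sigma> \<^bold>\<and> \<tau>"
| InterE1: "G \<tturnstile> M \<Ztypecolon> \<sigma> \<^bold>\<and> \<tau> \<Longrightarrow> G \<tturnstile> M \<Ztypecolon> \<sigma>"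
| InterE2: "G \<tturnstile> M \<Ztypecolon> \<sigma> \<^bold>\<and> \<tau> \<Longrightarrow> G \<tturnstile> M \<Ztypecolon> \<tau>"
| UnionI1: "G \<tturnstile> M \<Ztypecolon> \<sigma> \<Longrightarrow> G \<tturnstile> M \<Ztypecolon> \<sigma> \<^bold>\<or> \<tau>"
| UnionI2: "G \<tturnstile> M \<Ztypecolon> \<sigma> \<Longrightarrow> G \<tturnstile> M \<Ztypecolon> \<tau> \<^bold>\<or> \<sigma>"
| UnionE: "\<lbrakk> G \<triangleright> \<sigma> \<^bold>\<and> \<theta> \<tturnstile> M \<Ztypecolon> \<rho>; G \<triangleright> \<tau> \<^bold>\<and> \<theta> \<tturnstile> M \<Ztypecolon> \<rho>;
    G \<tturnstile> N \<Ztypecolon> (\<sigma> \<^bold>\<or> \<tau>) \<^bold>\<and> \<theta>; occ 0 M = 1 \<rbrakk> \<Longrightarrow> G \<tturnstile> inst M N \<Ztypecolon> \<rho>"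

lemma tp_ren:
  "D \<tturnstile> M \<Ztypecolon> \<tau> \<Longrightarrow> (\<And>k. occ k M > 0 \<Longrightarrow> G (f k) = D k) \<Longrightarrow> G \<tturnstile> ren f M \<Ztypecolon> \<tau>"
proof (induction arbitrary: G f rule: tp.induct)
  case (Ax D k)
  then show ?case using tp.Ax[of G "f k"] by simp
next
  case (ArrowI D \<sigma> M \<tau>)
  have "G \<triangleright> \<sigma> \<tturnstile> ren (upr f) M \<Ztypecolon> \<tau>"
  proof (rule ArrowI.IH)
    fix k assume "occ k M > 0"
    then show "(G \<triangleright> \<sigma>) (upr f k) = (D \<triangleright> \<sigma>) k"
      using ArrowI.prems by (cases k) simp_all
  qed
  then show ?case by (simp add: tp.ArrowI)
next
  case (ArrowE D M \<sigma> \<tau> N)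
  have "G \<tturnstile> ren f M \<Ztypecolon> \<sigma> \<^bold>\<rightarrow> \<tau>" by (rule ArrowE.IH(1), rule ArrowE.prems) simp
  moreover have "G \<tturnstile> ren f N \<Ztypecolon> \<sigma>" by (rule ArrowE.IH(2), rule ArrowE.prems) simp
  ultimately show ?case by (simp add: tp.ArrowE)
next
  case (UnionE D \<sigma> \<theta> M \<rho> \<tau> N)
  have *: "(G \<triangleright> \<alpha>) (upr f k) = (D \<triangleright> \<alpha>) k" if "occ k M > 0" for \<alpha> k
    using that UnionE.prems by (cases k) (simp_all add: occ_inst)
  have "G \<tturnstile> inst (ren (upr f) M) (ren f N) \<Ztypecolon> \<rho>"
  proof (rule tp.UnionE)
    show "G \<tturnstile> ren f N \<Ztypecolon> (\<sigma> \<^bold>\<or> \<tau>) \<^bold>\<and> \<theta>"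
      by (rule UnionE.IH(3), rule UnionE.prems) (simp add: occ_inst UnionE.hyps)
  qed (use UnionE.IH(1,2) * UnionE.hyps in auto)
  then show ?case by (simp add: ren_inst)
qed (auto intro: tp.intros)

lemma tp_sub:
  "D \<tturnstile> M \<Ztypecolon> \<tau> \<Longrightarrow> (\<And>k. occ k M > 0 \<Longrightarrow> G \<tturnstile> s k \<Ztypecolon> D k) \<Longrightarrow> G \<tturnstile> sub s M \<Ztypecolon> \<tau>"
proof (induction arbitrary: G s rule: tp.induct)
  case (Ax D k)
  then show ?case by simp
next
  case (ArrowI D \<sigma> M \<tau>)
  have "G \<triangleright> \<sigma> \<tturnstile> sub (up s) M \<Ztypecolon> \<tau>"
  proof (rule ArrowI.IH)
    fix k assume k: "occ k M > 0"
    show "G \<triangleright> \<sigma> \<tturnstile> up s k \<Ztypecolon> (D \<triangleright> \<sigma>) k"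
    proof (cases k)
      case 0
      then show ?thesis using tp.Ax[of "G \<triangleright> \<sigma>" 0] by simp
    next
      case (Suc j)
      then have "G \<tturnstile> s j \<Ztypecolon> D j" using k by (intro ArrowI.prems) simp
      then have "G \<triangleright> \<sigma> \<tturnstile> ren Suc (s j) \<Ztypecolon> D j" by (rule tp_ren) simp
      then show ?thesis using Suc by simp
    qed
  qed
  then show ?case by (simp add: tp.ArrowI)
next
  case (ArrowE D M \<sigma> \<tau> N)
  have "G \<tturnstile> sub s M \<Ztypecolon> \<sigma> \<^bold>\<rightarrow> \<tau>" by (rule ArrowE.IH(1), rule ArrowE.prems) simp
  moreover have "G \<tturnstile> sub s N \<Ztypecolon> \<sigma>" by (rule ArrowE.IH(2), rule ArrowE.prems) simp
  ultimately show ?case by (simp add: tp.ArrowE)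
next
  case (UnionE D \<sigma> \<theta> M \<rho> \<tau> N)
  have *: "G \<triangleright> \<alpha> \<tturnstile> up s k \<Ztypecolon> (D \<triangleright> \<alpha>) k" if k: "occ k M > 0" for \<alpha> k
  proof (cases k)
    case 0
    then show ?thesis using tp.Ax[of "G \<triangleright> \<alpha>" 0] by simp
  next
    case (Suc j)
    then have "G \<tturnstile> s j \<Ztypecolon> D j" using k by (intro UnionE.prems) (simp add: occ_inst)
    then have "G \<triangleright> \<alpha> \<tturnstile> ren Suc (s j) \<Ztypecolon> D j" by (rule tp_ren) simp
    then show ?thesis using Suc by simp
  qed
  have "G \<tturnstile> inst (sub (up s) M) (sub s N) \<Ztypecolon> \<rho>"
  proof (rule tp.UnionE)
    show "G \<tturnstile> sub s N \<Ztypecolon> (\<sigma> \<^bold>\<or> \<tau>) \<^bold>\<and> \<theta>"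
      by (rule UnionE.IH(3), rule UnionE.prems) (simp add: occ_inst UnionE.hyps)
  qed (use UnionE.IH(1,2) * UnionE.hyps in auto)
  then show ?case by (simp add: sub_inst_up)
qed (auto intro: tp.intros)

lemma tp_cut: "G \<triangleright> \<sigma> \<tturnstile> M \<Ztypecolon> \<tau> \<Longrightarrow> G \<tturnstile> N \<Ztypecolon> \<sigma> \<Longrightarrow> G \<tturnstile> inst M N \<Ztypecolon> \<tau>"
  by (erule tp_sub) (auto intro: tp.Ax split: nat.split)

lemma tp_weaken:
  "D \<tturnstile> M \<Ztypecolon> \<tau> \<Longrightarrow> (\<And>k. occ k M > 0 \<Longrightarrow> G \<tturnstile> Var k \<Ztypecolon> D k) \<Longrightarrow> G \<tturnstile> M \<Ztypecolon> \<tau>"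
  using tp_sub[of D M \<tau> G Var] by simp

lemma tp_cong: "D \<tturnstile> M \<Ztypecolon> \<tau> \<Longrightarrow> (\<And>k. occ k M > 0 \<Longrightarrow> G k = D k) \<Longrightarrow> G \<tturnstile> M \<Ztypecolon> \<tau>"
  by (erule tp_weaken) (metis tp.Ax)

text \<open>If an instance that really contains the substituted term is a variable, then
  \<open>M = Var 0\<close>, and union elimination reduces to distributivity in the lattice
  order.\<close>

lemma tp_sat_Var:
  "G \<tturnstile> M \<Ztypecolon> \<tau> \<Longrightarrow> M = Var k \<Longrightarrow> G k \<sqsubseteq> \<tau>"
proof (induction arbitrary: k rule: tp.induct)
  case (UnionE G \<sigma> \<theta> M \<rho> \<tau> N)
  from UnionE.prems UnionE.hyps have "M = Var 0" by (cases M) (auto split: if_splits nat.splits)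
  with UnionE show ?case by (force simp: entails_def)
qed (auto simp: entails_def)

lemma tp_conj_set: "G \<tturnstile> M \<Ztypecolon> \<mu> \<Longrightarrow> \<sigma> \<in> conj_set \<mu> \<Longrightarrow> G \<tturnstile> M \<Ztypecolon> \<sigma>"
  by (induction \<mu>) (auto dest: tp.InterE1 tp.InterE2)

lemma tp_satI: "(\<And>\<sigma>. \<sigma> \<in> S \<Longrightarrow> G \<tturnstile> M \<Ztypecolon> \<sigma>) \<Longrightarrow> sat S \<tau> \<Longrightarrow> G \<tturnstile> M \<Ztypecolon> \<tau>"
  by (induction \<tau>) (auto intro: tp.InterI tp.UnionI1 tp.UnionI2)

text \<open>Union elimination is applied to variable \<open>0\<close> itself. In the intersection
  case \<open>\<theta>\<close> must vary: it holds first the conjunct not yet split, then the member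
  already selected from the other one.\<close>

lemma tp_split_Inter:
  "occ 0 M = 1 \<Longrightarrow> (\<And>\<mu>. \<mu> \<in> disj_set (w \<sigma>) \<Longrightarrow> G \<triangleright> \<mu> \<^bold>\<and> \<theta> \<tturnstile> M \<Ztypecolon> \<rho>) \<Longrightarrow> G \<triangleright> \<sigma> \<^bold>\<and> \<theta> \<tturnstile> M \<Ztypecolon> \<rho>"
proof (induction \<sigma> arbitrary: \<theta>)
  case (Union \<sigma> \<tau>)
  let ?M = "ren (upr Suc) M" and ?G = "G \<triangleright> (\<sigma> \<^bold>\<or> \<tau>) \<^bold>\<and> \<theta>"
  have *: "?G \<triangleright> \<alpha> \<tturnstile> ?M \<Ztypecolon> \<rho>" if "G \<triangleright> \<alpha> \<tturnstile> M \<Ztypecolon> \<rho>" for \<alpha>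
    using that by (rule tp_ren) (simp add: upr_def split: nat.split)
  have "?G \<tturnstile> inst ?M (Var 0) \<Ztypecolon> \<rho>"
  proof (rule tp.UnionE)
    show "?G \<triangleright> \<sigma> \<^bold>\<and> \<theta> \<tturnstile> ?M \<Ztypecolon> \<rho>" by (rule *, rule Union.IH) (use Union.prems in auto)
    show "?G \<triangleright> \<tau> \<^bold>\<and> \<theta> \<tturnstile> ?M \<Ztypecolon> \<rho>" by (rule *, rule Union.IH) (use Union.prems in auto)
    show "?G \<tturnstile> Var 0 \<Ztypecolon> (\<sigma> \<^bold>\<or> \<tau>) \<^bold>\<and> \<theta>" using tp.Ax[of ?G 0] by simp
  qed (use Union.prems in simp)
  moreover have "inst ?M (Var 0) = M"
    unfolding sub_ren by (rule sub_id) (simp add: upr_def split: nat.split)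
  ultimately show ?case by simp
next
  case (Inter \<sigma> \<tau>)
  have assoc: "G \<triangleright> \<beta> \<tturnstile> M \<Ztypecolon> \<rho>" if "G \<triangleright> \<alpha> \<tturnstile> M \<Ztypecolon> \<rho>" "G \<triangleright> \<beta> \<tturnstile> Var 0 \<Ztypecolon> \<alpha>" for \<alpha> \<beta>
    using that(1) by (rule tp_weaken) (use that(2) in \<open>metis tp.Ax not0_implies_Suc nat.case\<close>)
  have ax: "G \<triangleright> \<alpha> \<tturnstile> Var 0 \<Ztypecolon> \<alpha>" for \<alpha> using tp.Ax[of "G \<triangleright> \<alpha>" 0] by simp
  have "G \<triangleright> \<sigma> \<^bold>\<and> (\<tau> \<^bold>\<and> \<theta>) \<tturnstile> M \<Ztypecolon> \<rho>"
  proof (rule Inter.IH(1)[OF Inter.prems(1)])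
    fix \<mu> assume \<mu>: "\<mu> \<in> disj_set (w \<sigma>)"
    have "G \<triangleright> \<tau> \<^bold>\<and> (\<mu> \<^bold>\<and> \<theta>) \<tturnstile> M \<Ztypecolon> \<rho>"
    proof (rule Inter.IH(2)[OF Inter.prems(1)])
      fix \<nu> assume "\<nu> \<in> disj_set (w \<tau>)"
      with \<mu> have "G \<triangleright> (\<mu> \<^bold>\<and> \<nu>) \<^bold>\<and> \<theta> \<tturnstile> M \<Ztypecolon> \<rho>"
        by (intro Inter.prems) (auto simp: disj_set_w_Inter simp del: w.simps)
      then show "G \<triangleright> \<nu> \<^bold>\<and> (\<mu> \<^bold>\<and> \<theta>) \<tturnstile> M \<Ztypecolon> \<rho>"
        by (rule assoc) (meson ax tp.InterI tp.InterE1 tp.InterE2)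
    qed
    then show "G \<triangleright> \<mu> \<^bold>\<and> (\<tau> \<^bold>\<and> \<theta>) \<tturnstile> M \<Ztypecolon> \<rho>"
      by (rule assoc) (meson ax tp.InterI tp.InterE1 tp.InterE2)
  qed
  then show ?case by (rule assoc) (meson ax tp.InterI tp.InterE1 tp.InterE2)
qed auto

lemma tp_split_0:
  assumes "occ 0 M = 1" and "\<And>\<mu>. \<mu> \<in> disj_set (w \<sigma>) \<Longrightarrow> G \<triangleright> \<mu> \<tturnstile> M \<Ztypecolon> \<rho>"
  shows "G \<triangleright> \<sigma> \<tturnstile> M \<Ztypecolon> \<rho>"
proof -
  have ax: "G \<triangleright> \<alpha> \<tturnstile> Var 0 \<Ztypecolon> \<alpha>" for \<alpha> using tp.Ax[of "G \<triangleright> \<alpha>" 0] by simp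
  have weak: "G \<triangleright> \<beta> \<tturnstile> M \<Ztypecolon> \<rho>" if "G \<triangleright> \<alpha> \<tturnstile> M \<Ztypecolon> \<rho>" "G \<triangleright> \<beta> \<tturnstile> Var 0 \<Ztypecolon> \<alpha>" for \<alpha> \<beta>
    using that(1) by (rule tp_weaken) (use that(2) in \<open>metis tp.Ax not0_implies_Suc nat.case\<close>)
  \<comment> \<open>There is no top type to fill the side conjunct \<open>\<theta>\<close>, so
    \<open>\<sigma>\<close> is duplicated.\<close>
  have "G \<triangleright> \<sigma> \<^bold>\<and> \<sigma> \<tturnstile> M \<Ztypecolon> \<rho>"
    by (rule tp_split_Inter[OF assms(1)], rule weak, erule assms(2)) (meson ax tp.InterE1)
  then show ?thesis by (rule weak) (meson ax tp.InterI)
qed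

text \<open>For a basic intersection \<open>\<mu>\<close>, \<open>conj_set \<mu>\<close> is the
  least valuation satisfying it, so whatever is true there follows from the conjuncts of
  \<open>\<mu>\<close> by introduction rules. Splitting a variable of type \<open>\<sigma>\<close>
  into such \<open>\<mu>\<close> reduces the claim to this, and a cut passes from the variable to
  \<open>M\<close>.\<close>

lemma tp_entails:
  assumes "G \<tturnstile> M \<Ztypecolon> \<sigma>" and "\<sigma> \<sqsubseteq> \<tau>"
  shows "G \<tturnstile> M \<Ztypecolon> \<tau>"
proof -
  have "G \<triangleright> \<sigma> \<tturnstile> Var 0 \<Ztypecolon> \<tau>"
  proof (rule tp_split_0)
    fix \<mu> assume "\<mu> \<in> disj_set (w \<sigma>)"
    moreover from this have "sat (conj_set \<mu>) \<mu>" by (simp add: sat_binter w_binter)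
    ultimately have "sat (conj_set \<mu>) \<sigma>" using sat_w by blast
    then have "sat (conj_set \<mu>) \<tau>" using assms(2) by (simp add: entails_def)
    moreover have "G \<triangleright> \<mu> \<tturnstile> Var 0 \<Ztypecolon> \<alpha>" if "\<alpha> \<in> conj_set \<mu>" for \<alpha>
      using tp_conj_set[OF tp.Ax[of "G \<triangleright> \<mu>" 0]] that by simp
    ultimately show "G \<triangleright> \<mu> \<tturnstile> Var 0 \<Ztypecolon> \<tau>" by (rule tp_satI[rotated])
  qed simp
  from tp_cut[OF this assms(1)] show ?thesis by simp
qed

lemma tp_Var_iff: "G \<tturnstile> Var k \<Ztypecolon> \<tau> \<longleftrightarrow> G k \<sqsubseteq> \<tau>"
  using tp_sat_Var tp_entails[OF tp.Ax] by blast

lemma tp_env_mono: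
  "D \<tturnstile> M \<Ztypecolon> \<tau> \<Longrightarrow> (\<And>k. occ k M > 0 \<Longrightarrow> G k \<sqsubseteq> D k) \<Longrightarrow> G \<tturnstile> M \<Ztypecolon> \<tau>"
  by (erule tp_weaken) (simp add: tp_Var_iff)

lemma tp_split:
  assumes "occ k M = 1" and "\<And>\<mu>. \<mu> \<in> disj_set (w \<sigma>) \<Longrightarrow> G(k := \<mu>) \<tturnstile> M \<Ztypecolon> \<rho>"
  shows "G(k := \<sigma>) \<tturnstile> M \<Ztypecolon> \<rho>"
proof -
  let ?f = "\<lambda>i. if i = k then 0 else Suc i"
  have "G(k := \<sigma>) \<triangleright> \<sigma> \<tturnstile> ren ?f M \<Ztypecolon> \<rho>"
  proof (rule tp_split_0)
    show "occ 0 (ren ?f M) = 1"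
      using occ_sub1[of 0 "\<lambda>i. Var (?f i)" k 1 M] assms(1) by (simp add: ren_sub)
    fix \<mu> assume "\<mu> \<in> disj_set (w \<sigma>)"
    from assms(2)[OF this] show "G(k := \<sigma>) \<triangleright> \<mu> \<tturnstile> ren ?f M \<Ztypecolon> \<rho>" by (rule tp_ren) simp
  qed
  from tp_cut[OF this, of "Var k"] have "G(k := \<sigma>) \<tturnstile> inst (ren ?f M) (Var k) \<Ztypecolon> \<rho>"
    by (simp add: tp_Var_iff)
  moreover have "inst (ren ?f M) (Var k) = M"
    unfolding sub_ren by (rule sub_id) simp
  ultimately show ?thesis by simp
qed

section \<open>Typings of substitution instances\<close>

text \<open>Closed form of \<open>up\<close> iterated \<open>d\<close> times;
  \<open>hole d N\<close> thus puts \<open>N\<close> for index \<open>d\<close> below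
  \<open>d\<close> binders without capture.\<close>

definition upn :: "nat \<Rightarrow> (nat \<Rightarrow> trm) \<Rightarrow> nat \<Rightarrow> trm" where
  "upn d s i = (if i < d then Var i else ren (\<lambda>j. j + d) (s (i - d)))"

abbreviation hole :: "nat \<Rightarrow> trm \<Rightarrow> nat \<Rightarrow> trm" where
  "hole d N \<equiv> upn d (case_nat N Var)"

lemma upn_0 [simp]: "upn 0 s = s"
  by (rule ext) (simp add: upn_def ren_id)

lemma up_upn: "up (upn d s) = upn (Suc d) s"
  by (rule ext) (simp add: up_def upn_def ren_ren comp_def split: nat.split)

lemma ren_add_minus [simp]: "ren (\<lambda>j. j - d) (ren (\<lambda>j. j + d) M) = M"
  by (simp add: ren_ren ren_id)

lemma occ_ren_add: "occ (k + d) (ren (\<lambda>j. j + d) M) = occ k M"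
  by (rule occ_ren_inj) (simp add: inj_def)

lemma occ_ren_add_less: "k < d \<Longrightarrow> occ k (ren (\<lambda>j. j + d) M) = 0"
  by (simp add: ren_sub occ_sub_0)

lemma occ_upn_less:
  assumes "k < d"
  shows "occ k (sub (upn d s) M) = occ k M"
proof -
  have "occ k (sub (upn d s) M) = 1 * occ k M"
    by (rule occ_sub1) (use assms in \<open>auto simp: upn_def occ_ren_add_less\<close>)
  then show ?thesis by simp
qed

lemma ren_minus_add:
  assumes "\<And>k. k < d \<Longrightarrow> occ k M = 0"
  shows "ren (\<lambda>j. j + d) (ren (\<lambda>j. j - d) M) = M"
  unfolding ren_ren
proof (rule ren_id)
  fix i assume "occ i M > 0"
  then have "\<not> i < d" using assms[of i] by auto
  then show "((\<lambda>j. j + d) \<circ> (\<lambda>j. j - d)) i = i" by simp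
qed

lemma sub_upn_ren_add: "sub (upn d s) (ren (\<lambda>j. j + d) M) = ren (\<lambda>j. j + d) (sub s M)"
  by (simp add: sub_ren ren_sub_comp upn_def comp_def)

section \<open>Overlaps of a substitution instance with a one-hole context\<close>

lemma sub_upn_ren_skip:
  "sub (upn d t) (ren (\<lambda>i. if i < d then i else Suc i) M) = sub (upn d (\<lambda>j. t (Suc j))) M"
proof -
  have "upn d t \<circ> (\<lambda>i. if i < d then i else Suc i) = upn d (\<lambda>j. t (Suc j))"
    by (rule ext) (simp add: upn_def Suc_diff_le)
  then show ?thesis by (simp add: sub_ren)
qed

text \<open>Serves the side of an application that misses the hole: making room for index
  \<open>d\<close> on both sides cancels the instantiation, since no variable of \<open>K\<close> is
  the hole.\<close>

lemma overlap_other: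
  assumes "occ d K = 0" and "sub (upn d s) M = sub (hole d N) K"
  shows "K = sub (upn d (\<lambda>j. ren Suc (s j))) M"
proof -
  let ?f = "\<lambda>i. if i < d then i else Suc i"
  have f: "ren ?f (upn d s i) = upn d (\<lambda>j. ren Suc (s j)) i" for s i
    by (simp add: upn_def ren_ren comp_def)
  have "sub (upn d (\<lambda>j. ren Suc (s j))) M = ren ?f (sub (upn d s) M)"
    by (simp add: ren_sub_comp f)
  also have "\<dots> = sub (\<lambda>i. ren ?f (hole d N i)) K"
    by (simp add: assms(2) ren_sub_comp)
  also have "\<dots> = K"
  proof (rule sub_id)
    fix i assume "occ i K > 0"
    with assms(1) have "i \<noteq> d" by auto
    then show "ren ?f (hole d N i) = Var i"
      by (auto simp: upn_def split: nat.split)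
  qed
  finally show ?thesis by simp
qed

text \<open>Index \<open>d\<close> of \<open>K\<close> is the hole, so the images under
  \<open>s\<close> that do not contain \<open>N\<close> are shifted to make room for it.\<close>

definition inner :: "nat \<Rightarrow> (nat \<Rightarrow> trm) \<Rightarrow> trm \<Rightarrow> trm \<Rightarrow> trm \<Rightarrow> bool" where
  "inner d s M N K \<longleftrightarrow> (\<exists>k N0. occ (d + k) M = 1 \<and> occ 0 N0 = 1 \<and> s k = inst N0 N
     \<and> K = sub (upn d (\<lambda>j. if j = k then N0 else ren Suc (s j))) M)"

definition outer :: "nat \<Rightarrow> (nat \<Rightarrow> trm) \<Rightarrow> trm \<Rightarrow> trm \<Rightarrow> trm \<Rightarrow> bool" where
  "outer d s M N K \<longleftrightarrow> (\<exists>M0 M'. occ d M0 = 1 \<and> M = sub (hole d M') M0 \<and> N = sub s M'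
     \<and> K = sub (upn d (up s)) M0)"

text \<open>The instance equals \<open>N\<close> lifted over the \<open>d\<close> binders and
  contains none of their variables. Hence \<open>M\<close> contains none either and is itself a
  lift, of the wanted \<open>M'\<close>.\<close>

lemma overlap_hole:
  assumes "sub (upn d s) M = sub (hole d N) (Var d)"
  shows "outer d s M N (Var d)"
proof -
  have eq: "sub (upn d s) M = ren (\<lambda>j. j + d) N" using assms by (simp add: upn_def)
  have "occ k M = 0" if "k < d" for k
    using arg_cong[OF eq, of "occ k"] that by (simp add: occ_upn_less occ_ren_add_less)
  then have M: "ren (\<lambda>j. j + d) (ren (\<lambda>j. j - d) M) = M" by (rule ren_minus_add)
  let ?M' = "ren (\<lambda>j. j - d) M"
  have "ren (\<lambda>j. j + d) N = ren (\<lambda>j. j + d) (sub s ?M')"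
    using eq M sub_upn_ren_add[of d s ?M'] by simp
  then have "N = sub s ?M'" by (metis ren_add_minus)
  then show ?thesis
    using M unfolding outer_def by (intro exI[of _ "Var d"] exI[of _ ?M']) (simp add: upn_def)
qed

text \<open>The image of a variable not among the \<open>d\<close> bound ones avoids those, so
  \<open>K\<close> does too; lowered by \<open>d\<close>, it is the context of \<open>N\<close> in
  that image.\<close>

lemma overlap_Var:
  assumes "d \<le> i" and "occ d K = 1" and "sub (upn d s) (Var i) = sub (hole d N) K"
  shows "inner d s (Var i) N K"
proof -
  have eq: "ren (\<lambda>j. j + d) (s (i - d)) = sub (hole d N) K"
    using assms by (simp add: upn_def)
  have "occ k K = 0" if "k < d" for k
    using arg_cong[OF eq, of "occ k"] that by (simp add: occ_upn_less occ_ren_add_less)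
  then have K: "ren (\<lambda>j. j + d) (ren (\<lambda>j. j - d) K) = K" by (rule ren_minus_add)
  let ?K = "ren (\<lambda>j. j - d) K"
  have "ren (\<lambda>j. j + d) (s (i - d)) = ren (\<lambda>j. j + d) (inst ?K N)"
    using eq K sub_upn_ren_add[of d "case_nat N Var" ?K] by simp
  then have "s (i - d) = inst ?K N" by (metis ren_add_minus)
  moreover have "occ 0 ?K = 1" using occ_ren_add[of 0 d ?K] K assms(2) by simp
  ultimately show ?thesis
    using K assms(1) unfolding inner_def
    by (intro exI[of _ "i - d"] exI[of _ ?K]) (simp add: upn_def)
qed

lemma overlap_AppL:
  assumes "inner d s M N K \<or> outer d s M N K"
    and "\<And>k. k \<ge> d \<Longrightarrow> occ k (App M L) \<le> 1"
    and "L' = sub (upn d (\<lambda>j. ren Suc (s j))) L"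
  shows "inner d s (App M L) N (App K L') \<or> outer d s (App M L) N (App K L')"
  using assms(1)
proof
  assume "inner d s M N K"
  then obtain k N0 where k: "occ (d + k) M = 1" "occ 0 N0 = 1" "s k = inst N0 N"
    "K = sub (upn d (\<lambda>j. if j = k then N0 else ren Suc (s j))) M"
    unfolding inner_def by blast
  \<comment> \<open>By linearity the variable whose image contains \<open>N\<close> occurs in
    \<open>M\<close> and not in \<open>L\<close>, so exchanging its image leaves \<open>L'\<close>
    unchanged.\<close>
  have L: "occ (d + k) L = 0" using assms(2)[of "d + k"] k(1) by simp
  have "L' = sub (upn d (\<lambda>j. if j = k then N0 else ren Suc (s j))) L"
    unfolding assms(3) by (rule sub_cong) (use L in \<open>auto simp: upn_def\<close>)
  then have "inner d s (App M L) N (App K L')"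
    unfolding inner_def using k L by (intro exI[of _ k] exI[of _ N0]) simp
  then show ?thesis ..
next
  assume "outer d s M N K"
  then obtain M0 M' where M0: "occ d M0 = 1" "M = sub (hole d M') M0" "N = sub s M'"
    "K = sub (upn d (up s)) M0"
    unfolding outer_def by blast
  let ?L = "ren (\<lambda>i. if i < d then i else Suc i) L"
  have "occ d ?L = 0" unfolding ren_sub by (rule occ_sub_0) simp
  moreover have "sub (hole d M') ?L = L"
    unfolding sub_upn_ren_skip by (rule sub_id) (simp add: upn_def)
  moreover have "sub (upn d (up s)) ?L = L'"
    unfolding sub_upn_ren_skip assms(3) by simp
  ultimately have "outer d s (App M L) N (App K L')"
    unfolding outer_def using M0 by (intro exI[of _ "App M0 ?L"] exI[of _ M']) simp
  then show ?thesis ..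
qed

text \<open>By symmetry: the two sides are swapped, and the resulting context is swapped back. Its
  root cannot be the hole, because filling it yields an application.\<close>

lemma overlap_AppR:
  assumes "inner d s M N K \<or> outer d s M N K"
    and "\<And>k. k \<ge> d \<Longrightarrow> occ k (App L M) \<le> 1"
    and "L' = sub (upn d (\<lambda>j. ren Suc (s j))) L"
  shows "inner d s (App L M) N (App L' K) \<or> outer d s (App L M) N (App L' K)"
proof -
  have "inner d s (App M L) N (App K L') \<or> outer d s (App M L) N (App K L')"
    by (rule overlap_AppL[OF assms(1) _ assms(3)]) (use assms(2) in \<open>simp add: add.commute\<close>)
  then show ?thesis
  proof
    assume "inner d s (App M L) N (App K L')"
    then have "inner d s (App L M) N (App L' K)" unfolding inner_def by (auto simp: add.commute)
    then show ?thesis ..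
  next
    assume "outer d s (App M L) N (App K L')"
    then obtain M0 M' where M0: "occ d M0 = 1" "App M L = sub (hole d M') M0" "N = sub s M'"
      "App K L' = sub (upn d (up s)) M0"
      unfolding outer_def by blast
    show ?thesis
    proof (cases M0)
      case (Var i)
      then have "i = d" using M0(1) by (simp split: if_splits)
      with Var M0(4) show ?thesis by (simp add: upn_def)
    next
      case (App A B)
      then have "outer d s (App L M) N (App L' K)"
        unfolding outer_def using M0 by (intro exI[of _ "App B A"] exI[of _ M']) simp
      then show ?thesis ..
    qed (use M0 in simp)
  qed
qed

text \<open>The two ways in which a substitution instance can contain a subterm \<open>N\<close>: either \<open>N\<close> lies
  inside the image of a variable, or \<open>N\<close> is itself an instance of a subterm.\<close>

lemma overlap:
  assumes "sub (upn d s) M = sub (hole d N) K" and "occ d K = 1"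
    and "\<And>k. k \<ge> d \<Longrightarrow> occ k M \<le> 1"
  shows "inner d s M N K \<or> outer d s M N K"
  using assms
proof (induction M arbitrary: d K)
  case (Var i)
  show ?case
  proof (cases "d \<le> i")
    case True
    then show ?thesis using overlap_Var Var.prems by blast
  next
    case False
    then have "sub (upn d s) (Var i) = Var i" by (simp add: upn_def)
    then have "sub (hole d N) K = Var i" using Var.prems(1) by metis
    then have "K = Var d" using Var.prems(2) by (cases K) (auto split: if_splits)
    then show ?thesis using overlap_hole Var.prems by blast
  qed
next
  case (App M1 M2)
  show ?case
  proof (cases K)
    case (Var i)
    then have "K = Var d" using App.prems(2) by (simp split: if_splits)
    then show ?thesis using overlap_hole App.prems(1) by blast
  next
    case (App K1 K2)
    have eq: "sub (upn d s) M1 = sub (hole d N) K1" "sub (upn d s) M2 = sub (hole d N) K2"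
      using App App.prems(1) by simp_all
    have le: "occ k M1 \<le> 1" "occ k M2 \<le> 1" if "d \<le> k" for k using App.prems(3)[OF that] by simp_all
    consider "occ d K1 = 1" "occ d K2 = 0" | "occ d K1 = 0" "occ d K2 = 1"
      using App.prems(2) App by fastforce
    then show ?thesis
    proof cases
      case 1
      show ?thesis unfolding App
        by (rule overlap_AppL[OF App.IH(1)[OF eq(1) 1(1) le(1)] App.prems(3)
              overlap_other[OF 1(2) eq(2)]])
    next
      case 2
      show ?thesis unfolding App
        by (rule overlap_AppR[OF App.IH(2)[OF eq(2) 2(2) le(2)] App.prems(3)
              overlap_other[OF 2(1) eq(1)]])
    qed
  qed (use App.prems in simp)
next
  case (Lam M)
  show ?case
  proof (cases K)
    case (Var i)
    then have "K = Var d" using Lam.prems(2) by (simp split: if_splits)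
    then show ?thesis using overlap_hole Lam.prems(1) by blast
  next
    case (Lam K')
    have "inner (Suc d) s M N K' \<or> outer (Suc d) s M N K'"
    proof (rule Lam.IH)
      fix k assume "Suc d \<le> k"
      then show "occ k M \<le> 1" using Lam.prems(3)[of "k - 1"] by (cases k) simp_all
    qed (use Lam Lam.prems in \<open>simp_all add: up_upn\<close>)
    then show ?thesis
    proof
      assume "inner (Suc d) s M N K'"
      then have "inner d s (Lam M) N K" unfolding inner_def Lam by (auto simp: up_upn)
      then show ?thesis ..
    next
      assume "outer (Suc d) s M N K'"
      then obtain M0 M' where "occ (Suc d) M0 = 1" "M = sub (hole (Suc d) M') M0" "N = sub s M'"
        "K' = sub (upn (Suc d) (up s)) M0"
        unfolding outer_def by blast
      then have "outer d s (Lam M) N K" unfolding outer_def Lam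
        by (intro exI[of _ "Lam M0"] exI[of _ M']) (simp add: up_upn)
      then show ?thesis ..
    qed
  qed (use Lam.prems in simp)
qed

section \<open>Linear terms\<close>

primrec blin :: "trm \<Rightarrow> bool" where
  "blin (Var i) = True"
| "blin (App M N) = (blin M \<and> blin N)"
| "blin (Lam M) = (occ 0 M = 1 \<and> blin M)"

definition lin :: "trm \<Rightarrow> bool" where
  "lin M \<longleftrightarrow> blin M \<and> (\<forall>k. occ k M \<le> 1)"

lemma blin_ren [simp]: "blin (ren f M) = blin M"
  by (induction M arbitrary: f) simp_all

lemma blin_sub: "blin (sub s M) \<longleftrightarrow> blin M \<and> (\<forall>i. occ i M > 0 \<longrightarrow> blin (s i))"
proof (induction M arbitrary: s)
  case (Lam M)
  have "(\<forall>i. occ i M > 0 \<longrightarrow> blin (up s i)) \<longleftrightarrow> (\<forall>i. occ (Suc i) M > 0 \<longrightarrow> blin (s i))"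
  proof safe
    fix i assume "\<forall>i. occ i M > 0 \<longrightarrow> blin (up s i)" "occ (Suc i) M > 0"
    then show "blin (s i)" by (metis blin_ren up_simps(2))
  next
    fix i assume "\<forall>i. occ (Suc i) M > 0 \<longrightarrow> blin (s i)" "occ i M > 0"
    then show "blin (up s i)" by (cases i) simp_all
  qed
  with Lam show ?case by simp
qed auto

lemma blin_inst: "occ 0 M = 1 \<Longrightarrow> blin (inst M N) \<longleftrightarrow> blin M \<and> blin N"
  unfolding blin_sub by (auto split: nat.split)

lemma lin_App [simp]:
  "lin (App M N) \<longleftrightarrow> lin M \<and> lin N \<and> (\<forall>k. occ k M = 0 \<or> occ k N = 0)"
proof -
  have "a + b \<le> 1 \<longleftrightarrow> a \<le> 1 \<and> b \<le> 1 \<and> (a = 0 \<or> b = 0)" for a b :: nat by arith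
  then show ?thesis unfolding lin_def by auto
qed

lemma lin_Lam: "lin (Lam M) \<longleftrightarrow> lin M \<and> occ 0 M = 1"
proof -
  have "(\<forall>k. occ k M \<le> 1) \<longleftrightarrow> occ 0 M \<le> 1 \<and> (\<forall>k. occ (Suc k) M \<le> 1)"
    by (metis not0_implies_Suc)
  then show ?thesis unfolding lin_def by auto
qed

lemma lin_inst:
  assumes "occ 0 M = 1"
  shows "lin (inst M N) \<longleftrightarrow> lin M \<and> lin N \<and> (\<forall>k. occ (Suc k) M = 0 \<or> occ k N = 0)"
proof -
  have "a + b \<le> 1 \<longleftrightarrow> a \<le> 1 \<and> b \<le> 1 \<and> (a = 0 \<or> b = 0)" for a b :: nat by arith
  moreover have "(\<forall>k. occ k M \<le> 1) \<longleftrightarrow> (\<forall>k. occ (Suc k) M \<le> 1)"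
    using assms by (metis not0_implies_Suc order.refl)
  ultimately show ?thesis unfolding lin_def by (auto simp: blin_inst occ_inst assms)
qed

lemma tp_unlift: "G \<triangleright> \<alpha> \<tturnstile> ren Suc M \<Ztypecolon> \<tau> \<Longrightarrow> G \<tturnstile> M \<Ztypecolon> \<tau>"
proof -
  assume "G \<triangleright> \<alpha> \<tturnstile> ren Suc M \<Ztypecolon> \<tau>"
  then have "G \<tturnstile> ren (\<lambda>i. i - 1) (ren Suc M) \<Ztypecolon> \<tau>"
    by (rule tp_ren) (metis diff_Suc_1 less_irrefl nat.case(2) not0_implies_Suc occ_ren_Suc(1))
  then show ?thesis by (simp add: ren_ren ren_id)
qed

text \<open>The converse of the substitution lemma, which needs linearity: by the overlap lemma, a
  union elimination either acts inside the image of a variable, which then receives a union of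
  types, or on an instance of a subterm.\<close>

lemma tp_sub_decompose:
  assumes "G \<tturnstile> sub s M \<Ztypecolon> \<tau>" and "lin M"
  obtains D where "D \<tturnstile> M \<Ztypecolon> \<tau>" "\<And>k. occ k M > 0 \<Longrightarrow> G \<tturnstile> s k \<Ztypecolon> D k"
proof -
  have "\<exists>D. D \<tturnstile> M \<Ztypecolon> \<tau> \<and> (\<forall>k. occ k M > 0 \<longrightarrow> G \<tturnstile> s k \<Ztypecolon> D k)"
    if "G \<tturnstile> X \<Ztypecolon> \<tau>" "X = sub s M" "lin M" for X
    using that
  proof (induction arbitrary: s M rule: tp.induct)
    case (Ax G k)
    then obtain i where "M = Var i" by (cases M) auto
    with Ax show ?case using tp.Ax[of G k]
      by (intro exI[of _ "\<lambda>_. G k"]) (auto simp: tp_Var_iff[of "\<lambda>_. G k"])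
  next
    case (ArrowI G \<sigma> X \<tau>)
    show ?case
    proof (cases M)
      case (Var i)
      then show ?thesis using tp.ArrowI[OF ArrowI.hyps] ArrowI.prems
        by (intro exI[of _ "\<lambda>_. \<sigma> \<^bold>\<rightarrow> \<tau>"]) (auto simp: tp_Var_iff)
    next
      case (Lam M1)
      then have "lin M1" "occ 0 M1 = 1" using ArrowI.prems by (simp_all add: lin_Lam)
      with Lam ArrowI obtain D where D: "D \<tturnstile> M1 \<Ztypecolon> \<tau>"
        "\<And>k. occ k M1 > 0 \<Longrightarrow> G \<triangleright> \<sigma> \<tturnstile> up s k \<Ztypecolon> D k" by fastforce
      have "\<sigma> \<sqsubseteq> D 0" using D(2)[of 0] \<open>occ 0 M1 = 1\<close> by (simp add: tp_Var_iff)
      have "(\<lambda>k. D (Suc k)) \<triangleright> \<sigma> \<tturnstile> M1 \<Ztypecolon> \<tau>"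
        using D(1) by (rule tp_env_mono) (use \<open>\<sigma> \<sqsubseteq> D 0\<close> in \<open>simp split: nat.split\<close>)
      then have "(\<lambda>k. D (Suc k)) \<tturnstile> M \<Ztypecolon> \<sigma> \<^bold>\<rightarrow> \<tau>" unfolding Lam by (rule tp.ArrowI)
      moreover have "G \<tturnstile> s k \<Ztypecolon> D (Suc k)" if "occ k M > 0" for k
        using D(2)[of "Suc k"] that Lam by (auto intro: tp_unlift)
      ultimately show ?thesis by blast
    qed (use ArrowI.prems in simp)
  next
    case (ArrowE G X \<sigma> \<tau> Y)
    show ?case
    proof (cases M)
      case (Var i)
      then show ?thesis using tp.ArrowE[OF ArrowE.hyps] ArrowE.prems
        by (intro exI[of _ "\<lambda>_. \<tau>"]) (auto simp: tp_Var_iff)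
    next
      case (App M1 M2)
      then have l: "lin M1" "lin M2" "\<And>k. occ k M1 = 0 \<or> occ k M2 = 0"
        using ArrowE.prems by simp_all
      obtain D1 where D1: "D1 \<tturnstile> M1 \<Ztypecolon> \<sigma> \<^bold>\<rightarrow> \<tau>" "\<forall>k. occ k M1 > 0 \<longrightarrow> G \<tturnstile> s k \<Ztypecolon> D1 k"
        using ArrowE.IH(1)[of s M1] ArrowE.prems App l by auto
      obtain D2 where D2: "D2 \<tturnstile> M2 \<Ztypecolon> \<sigma>" "\<forall>k. occ k M2 > 0 \<longrightarrow> G \<tturnstile> s k \<Ztypecolon> D2 k"
        using ArrowE.IH(2)[of s M2] ArrowE.prems App l by auto
      let ?D = "\<lambda>k. if occ k M1 > 0 then D1 k else D2 k"
      have "?D \<tturnstile> M1 \<Ztypecolon> \<sigma> \<^bold>\<rightarrow> \<tau>" using D1(1) by (rule tp_cong) simp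
      moreover have "?D \<tturnstile> M2 \<Ztypecolon> \<sigma>" using D2(1)
      proof (rule tp_cong)
        fix k assume "occ k M2 > 0"
        then show "?D k = D2 k" using l(3)[of k] by auto
      qed
      ultimately have "?D \<tturnstile> M \<Ztypecolon> \<tau>" unfolding App by (rule tp.ArrowE)
      moreover have "\<forall>k. occ k M > 0 \<longrightarrow> G \<tturnstile> s k \<Ztypecolon> ?D k" using D1(2) D2(2) App by auto
      ultimately show ?thesis by blast
    qed (use ArrowE.prems in simp)
  next
    case (InterI G X \<sigma> \<tau>)
    obtain D1 where D1: "D1 \<tturnstile> M \<Ztypecolon> \<sigma>" "\<forall>k. occ k M > 0 \<longrightarrow> G \<tturnstile> s k \<Ztypecolon> D1 k"
      using InterI by blast
    obtain D2 where D2: "D2 \<tturnstile> M \<Ztypecolon> \<tau>" "\<forall>k. occ k M > 0 \<longrightarrow> G \<tturnstile> s k \<Ztypecolon> D2 k"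
      using InterI by blast
    let ?D = "\<lambda>k. D1 k \<^bold>\<and> D2 k"
    have "?D \<tturnstile> M \<Ztypecolon> \<sigma>" using D1(1) by (rule tp_env_mono) (simp add: entails_def)
    moreover have "?D \<tturnstile> M \<Ztypecolon> \<tau>" using D2(1) by (rule tp_env_mono) (simp add: entails_def)
    ultimately show ?case using D1(2) D2(2) by (blast intro: tp.InterI)
  next
    case (InterE1 G X \<sigma> \<tau>)
    from InterE1.IH[OF InterE1.prems] show ?case by (blast intro: tp.InterE1)
  next
    case (InterE2 G X \<sigma> \<tau>)
    from InterE2.IH[OF InterE2.prems] show ?case by (blast intro: tp.InterE2)
  next
    case (UnionI1 G X \<sigma> \<tau>)
    from UnionI1.IH[OF UnionI1.prems] show ?case by (blast intro: tp.UnionI1)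
  next
    case (UnionI2 G X \<sigma> \<tau>)
    from UnionI2.IH[OF UnionI2.prems] show ?case by (blast intro: tp.UnionI2)
  next
    case (UnionE G \<sigma> \<theta> K \<rho> \<tau> N)
    have "inner 0 s M N K \<or> outer 0 s M N K"
      by (rule overlap) (use UnionE.prems UnionE.hyps in \<open>auto simp: lin_def\<close>)
    then show ?case
    proof
      assume "inner 0 s M N K"
      then obtain k N0 where k: "occ k M = 1" "occ 0 N0 = 1" "s k = inst N0 N"
        "K = sub (\<lambda>j. if j = k then N0 else ren Suc (s j)) M"
        unfolding inner_def by auto
      let ?s = "\<lambda>j. if j = k then N0 else ren Suc (s j)"
      obtain D1 where D1: "D1 \<tturnstile> M \<Ztypecolon> \<rho>" "\<forall>j. occ j M > 0 \<longrightarrow> G \<triangleright> \<sigma> \<^bold>\<and> \<theta> \<tturnstile> ?s j \<Ztypecolon> D1 j"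
        using UnionE.IH(1)[OF k(4) UnionE.prems(2)] by blast
      obtain D2 where D2: "D2 \<tturnstile> M \<Ztypecolon> \<rho>" "\<forall>j. occ j M > 0 \<longrightarrow> G \<triangleright> \<tau> \<^bold>\<and> \<theta> \<tturnstile> ?s j \<Ztypecolon> D2 j"
        using UnionE.IH(2)[OF k(4) UnionE.prems(2)] by blast
      let ?D = "\<lambda>j. D1 j \<^bold>\<and> D2 j"
      \<comment> \<open>Which of the two types the image of \<open>k\<close> has depends on the
        branch, so \<open>k\<close> receives their union. The images of the other variables do not
        contain \<open>N\<close>; they have both types in the original environment.\<close>
      have "?D(k := D1 k \<^bold>\<or> D2 k) \<tturnstile> M \<Ztypecolon> \<rho>"
      proof (rule tp_split[OF k(1)])
        fix \<mu> assume "\<mu> \<in> disj_set (w (D1 k \<^bold>\<or> D2 k))"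
        then consider "\<mu> \<sqsubseteq> D1 k" | "\<mu> \<sqsubseteq> D2 k"
          using sat_w[of _ "D1 k"] sat_w[of _ "D2 k"] by (auto simp: entails_def)
        then show "?D(k := \<mu>) \<tturnstile> M \<Ztypecolon> \<rho>"
        proof cases
          case 1
          with D1(1) show ?thesis by (elim tp_env_mono) (simp add: entails_def)
        next
          case 2
          with D2(1) show ?thesis by (elim tp_env_mono) (simp add: entails_def)
        qed
      qed
      moreover have "G \<tturnstile> s j \<Ztypecolon> (?D(k := D1 k \<^bold>\<or> D2 k)) j" if "occ j M > 0" for j
      proof (cases "j = k")
        case True
        have "G \<triangleright> \<sigma> \<^bold>\<and> \<theta> \<tturnstile> N0 \<Ztypecolon> D1 k \<^bold>\<or> D2 k" 
          using D1(2)[rule_format, of k] k(1) by (auto intro!: tp.UnionI1)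
        moreover have "G \<triangleright> \<tau> \<^bold>\<and> \<theta> \<tturnstile> N0 \<Ztypecolon> D1 k \<^bold>\<or> D2 k" 
          using D2(2)[rule_format, of k] k(1) by (auto intro!: tp.UnionI2)
        ultimately have "G \<tturnstile> inst N0 N \<Ztypecolon> D1 k \<^bold>\<or> D2 k"
          using UnionE.hyps(3) k(2) by (rule tp.UnionE)
        with k(3) True show ?thesis by simp
      next
        case False
        then have "G \<tturnstile> s j \<Ztypecolon> D1 j" "G \<tturnstile> s j \<Ztypecolon> D2 j" 
          using D1(2)[rule_format, of j] D2(2)[rule_format, of j] that
          by (auto intro: tp_unlift)
        with False show ?thesis by (simp add: tp.InterI)
      qed
      ultimately show ?thesis by blast
    next
      assume "outer 0 s M N K"
      then obtain M0 M' where M0: "occ 0 M0 = 1" "M = inst M0 M'" "N = sub s M'" "K = sub (up s) M0"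
        unfolding outer_def by auto
      have l: "lin M0" "lin M'" "\<And>k. occ (Suc k) M0 = 0 \<or> occ k M' = 0"
        using UnionE.prems(2) M0 by (simp_all add: lin_inst)
      obtain D1 where D1: "D1 \<tturnstile> M0 \<Ztypecolon> \<rho>" "\<forall>j. occ j M0 > 0 \<longrightarrow> G \<triangleright> \<sigma> \<^bold>\<and> \<theta> \<tturnstile> up s j \<Ztypecolon> D1 j"
        using UnionE.IH(1)[OF M0(4) l(1)] by blast
      obtain D2 where D2: "D2 \<tturnstile> M0 \<Ztypecolon> \<rho>" "\<forall>j. occ j M0 > 0 \<longrightarrow> G \<triangleright> \<tau> \<^bold>\<and> \<theta> \<tturnstile> up s j \<Ztypecolon> D2 j"
        using UnionE.IH(2)[OF M0(4) l(1)] by blast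
      obtain D3 where D3: "D3 \<tturnstile> M' \<Ztypecolon> (\<sigma> \<^bold>\<or> \<tau>) \<^bold>\<and> \<theta>" "\<forall>j. occ j M' > 0 \<longrightarrow> G \<tturnstile> s j \<Ztypecolon> D3 j"
        using UnionE.IH(3)[OF M0(3) l(2)] by blast
      \<comment> \<open>By linearity the variables of \<open>M'\<close> do not occur in the context
        \<open>M0\<close>, so each variable is charged to only one of the two.\<close>
      let ?D = "\<lambda>j. if occ j M' > 0 then D3 j else D1 (Suc j) \<^bold>\<and> D2 (Suc j)"
      have e: "\<sigma> \<^bold>\<and> \<theta> \<sqsubseteq> D1 0" "\<tau> \<^bold>\<and> \<theta> \<sqsubseteq> D2 0"
        using D1(2)[rule_format, of 0] D2(2)[rule_format, of 0] M0(1) by (simp_all add: tp_Var_iff)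
      have "?D \<tturnstile> inst M0 M' \<Ztypecolon> \<rho>"
      proof (rule tp.UnionE)
        show "?D \<triangleright> \<sigma> \<^bold>\<and> \<theta> \<tturnstile> M0 \<Ztypecolon> \<rho>" using D1(1)
        proof (rule tp_env_mono)
          fix k assume "occ k M0 > 0"
          then show "(?D \<triangleright> \<sigma> \<^bold>\<and> \<theta>) k \<sqsubseteq> D1 k"
            using e l(3)[of "k - 1"] by (cases k) (auto simp: entails_def)
        qed
        show "?D \<triangleright> \<tau> \<^bold>\<and> \<theta> \<tturnstile> M0 \<Ztypecolon> \<rho>" using D2(1)
        proof (rule tp_env_mono)
          fix k assume "occ k M0 > 0"
          then show "(?D \<triangleright> \<tau> \<^bold>\<and> \<theta>) k \<sqsubseteq> D2 k"
            using e l(3)[of "k - 1"] by (cases k) (auto simp: entails_def)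
        qed
        show "?D \<tturnstile> M' \<Ztypecolon> (\<sigma> \<^bold>\<or> \<tau>) \<^bold>\<and> \<theta>" using D3(1) by (rule tp_cong) simp
      qed (fact M0(1))
      moreover have "G \<tturnstile> s j \<Ztypecolon> ?D j" if "occ j M > 0" for j
      proof (cases "occ j M' > 0")
        case True
        then show ?thesis using D3(2) by simp
      next
        case False
        then have "occ (Suc j) M0 > 0" using that M0 by (simp add: occ_inst)
        then have "G \<tturnstile> s j \<Ztypecolon> D1 (Suc j)" "G \<tturnstile> s j \<Ztypecolon> D2 (Suc j)"
          using D1(2)[rule_format, of "Suc j"] D2(2)[rule_format, of "Suc j"]
          by (auto intro: tp_unlift)
        with False show ?thesis by (simp add: tp.InterI)
      qed
      ultimately show ?thesis using M0(2) by blast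
    qed
  qed
  from this[OF assms(1) HOL.refl assms(2)] that show thesis by blast
qed

lemma tp_inst_decompose:
  assumes "G \<tturnstile> inst M N \<Ztypecolon> \<tau>" and "lin M" and "occ 0 M = 1"
  obtains \<rho> where "G \<tturnstile> N \<Ztypecolon> \<rho>" "G \<triangleright> \<rho> \<tturnstile> M \<Ztypecolon> \<tau>"
proof -
  obtain D where D: "D \<tturnstile> M \<Ztypecolon> \<tau>" "\<And>k. occ k M > 0 \<Longrightarrow> G \<tturnstile> case_nat N Var k \<Ztypecolon> D k"
    by (rule tp_sub_decompose[OF assms(1,2)]) blast
  have "G \<triangleright> D 0 \<tturnstile> M \<Ztypecolon> \<tau>" using D(1)
  proof (rule tp_env_mono)
    fix k assume "occ k M > 0"
    then show "(G \<triangleright> D 0) k \<sqsubseteq> D k" using D(2)[of k] by (cases k) (simp_all add: tp_Var_iff)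
  qed
  moreover have "G \<tturnstile> N \<Ztypecolon> D 0" using D(2)[of 0] assms(3) by simp
  ultimately show thesis using that by blast
qed

lemma tp_expand:
  assumes "G \<tturnstile> inst M (inst B K) \<Ztypecolon> \<tau>" and "lin M" "occ 0 M = 1" and "lin B" "occ 0 B = 1"
  shows "G \<tturnstile> inst M (App (Lam B) K) \<Ztypecolon> \<tau>"
proof -
  obtain \<rho> where \<rho>: "G \<tturnstile> inst B K \<Ztypecolon> \<rho>" "G \<triangleright> \<rho> \<tturnstile> M \<Ztypecolon> \<tau>"
    using tp_inst_decompose[OF assms(1-3)] .
  obtain \<alpha> where "G \<tturnstile> K \<Ztypecolon> \<alpha>" "G \<triangleright> \<alpha> \<tturnstile> B \<Ztypecolon> \<rho>"
    using tp_inst_decompose[OF \<rho>(1) assms(4,5)] .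
  then have "G \<tturnstile> App (Lam B) K \<Ztypecolon> \<rho>" by (blast intro: tp.ArrowI tp.ArrowE)
  with \<rho>(2) show ?thesis by (rule tp_cut)
qed

section \<open>Inversion in environments of basic intersections\<close>

text \<open>If no application of \<open>M\<close> is evaluated outside the scope of the abstractions of \<open>M\<close>, then the
  types of \<open>M\<close> are those true under a single valuation.\<close>

fun val :: "(nat \<Rightarrow> 'a ty) \<Rightarrow> trm \<Rightarrow> 'a ty set" where
  "val G (Var z) = conj_set (G z)"
| "val G (Lam B) = {\<sigma> \<^bold>\<rightarrow> \<tau> |\<sigma> \<tau>. G \<triangleright> \<sigma> \<tturnstile> B \<Ztypecolon> \<tau>}"
\<comment> \<open>A default: an application is itself non-captured, so its types are described by
  \<open>fil\<close> below instead of a valuation.\<close>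
| "val G (App M N) = {}"

text \<open>An application may have a union type but neither of its members, so its types are only a
  filter, generated by \<open>E\<close>, and not the prime filter given by a valuation.\<close>

inductive fil :: "'a ty set \<Rightarrow> 'a ty \<Rightarrow> bool" for E where
  base: "\<tau> \<in> E \<Longrightarrow> fil E \<tau>"
| Inter: "fil E \<sigma> \<Longrightarrow> fil E \<tau> \<Longrightarrow> fil E (\<sigma> \<^bold>\<and> \<tau>)"
| up: "fil E \<sigma> \<Longrightarrow> \<sigma> \<sqsubseteq> \<tau> \<Longrightarrow> fil E \<tau>"

lemma fil_mono: "fil E \<tau> \<Longrightarrow> E \<subseteq> E' \<Longrightarrow> fil E' \<tau>"
  by (induction rule: fil.induct) (auto intro: fil.intros)

lemma fil_Inters:
  assumes "fil E \<tau>"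
  obtains xs where "xs \<noteq> []" "set xs \<subseteq> E" "Inters xs \<sqsubseteq> \<tau>"
proof -
  have "\<exists>xs. xs \<noteq> [] \<and> set xs \<subseteq> E \<and> Inters xs \<sqsubseteq> \<tau>" using assms
  proof (induction rule: fil.induct)
    case (base \<tau>)
    then show ?case by (intro exI[of _ "[\<tau>]"]) simp
  next
    case (Inter \<sigma> \<tau>)
    then obtain xs ys where "xs \<noteq> []" "set xs \<subseteq> E" "Inters xs \<sqsubseteq> \<sigma>"
      "ys \<noteq> []" "set ys \<subseteq> E" "Inters ys \<sqsubseteq> \<tau>" by blast
    then show ?case by (intro exI[of _ "xs @ ys"]) (auto simp: entails_def sat_Inters)
  next
    case (up \<sigma> \<tau>)
    then show ?case by (blast intro: entails_trans)
  qed
  with that show thesis by blast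
qed

lemma tp_fil: "fil E \<tau> \<Longrightarrow> (\<And>\<sigma>. \<sigma> \<in> E \<Longrightarrow> G \<tturnstile> M \<Ztypecolon> \<sigma>) \<Longrightarrow> G \<tturnstile> M \<Ztypecolon> \<tau>"
  by (induction rule: fil.induct) (auto intro: tp.InterI tp_entails)

lemma val_tp: "sat (val G M) \<tau> \<Longrightarrow> \<not> nca M \<Longrightarrow> G \<tturnstile> M \<Ztypecolon> \<tau>"
proof (erule tp_satI[rotated])
  fix \<sigma> assume "\<sigma> \<in> val G M" "\<not> nca M"
  then show "G \<tturnstile> M \<Ztypecolon> \<sigma>"
    by (cases M) (auto simp: nca_App intro: tp.Ax tp_conj_set tp.ArrowI)
qed

text \<open>If \<open>X\<close> is the variable \<open>0\<close>, its valuation consists of the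
  conjuncts of \<open>\<mu>\<close>, which are basic and hence members of the valuation of
  \<open>N\<close>. If \<open>X\<close> is an abstraction, the inclusion is the substitution
  lemma.\<close>

lemma val_inst:
  assumes "\<not> nca (inst X N)" and "binter \<mu>" and "sat (val G N) \<mu>" and "\<not> nca N"
  shows "val (G \<triangleright> \<mu>) X \<subseteq> val G (inst X N)"
proof (cases X)
  case (Var i)
  then show ?thesis using assms by (cases i) (simp_all add: sat_binter)
next
  case (Lam B)
  have N: "G \<tturnstile> N \<Ztypecolon> \<mu>" using assms(3,4) by (rule val_tp)
  have "G \<triangleright> \<sigma> \<tturnstile> sub (up (case_nat N Var)) B \<Ztypecolon> \<tau>" if "G \<triangleright> \<mu> \<triangleright> \<sigma> \<tturnstile> B \<Ztypecolon> \<tau>" for \<sigma> \<tau>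
    using that
  proof (rule tp_sub)
    fix k
    have "G \<triangleright> \<sigma> \<tturnstile> ren Suc N \<Ztypecolon> \<mu>" using N by (rule tp_ren) simp
    then show "G \<triangleright> \<sigma> \<tturnstile> up (case_nat N Var) k \<Ztypecolon> (G \<triangleright> \<mu> \<triangleright> \<sigma>) k"
      by (simp add: up_def tp_Var_iff split: nat.split)
  qed
  then show ?thesis using Lam by auto
qed simp

lemma inst_eq_App:
  assumes "inst M N = App F K"
  obtains "M = Var 0" | F' K' where "M = App F' K'" "F = inst F' N" "K = inst K' N"
  using assms by (cases M) (auto split: nat.splits)

lemma occ_App_1:
  assumes "occ 0 (App F K) = 1"
  obtains "occ 0 F = 1" | "occ 0 K = 1"
  using assms by fastforce

text \<open>A valuation is prime: it makes one side of the union true, and then some basic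
  intersection of the weak normal form of that side.\<close>

lemma split_valuation:
  assumes "sat S ((\<sigma> \<^bold>\<or> \<tau>) \<^bold>\<and> \<theta>)"
  obtains \<mu> where "binter \<mu>" "sat S \<mu>" "\<mu> \<sqsubseteq> \<sigma> \<^bold>\<and> \<theta> \<or> \<mu> \<sqsubseteq> \<tau> \<^bold>\<and> \<theta>"
proof -
  have "\<exists>\<mu>. binter \<mu> \<and> sat S \<mu> \<and> \<mu> \<sqsubseteq> \<alpha>" if "sat S \<alpha>" for \<alpha>
    using that sat_w[of _ \<alpha>] w_binter[of _ \<alpha>] unfolding entails_def by blast
  from this[of "\<sigma> \<^bold>\<and> \<theta>"] this[of "\<tau> \<^bold>\<and> \<theta>"] assms that show thesis by auto
qed

text \<open>The shape of the next statement with its parts abstracted; it settles the rules that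
  merely weaken a type.\<close>

lemma inversion_up:
  assumes "(A \<longrightarrow> sat S \<rho>) \<and> (\<forall>F K. B F K \<longrightarrow> C F \<longrightarrow> D K \<longrightarrow> fil (E F K) \<rho>)" and "\<rho> \<sqsubseteq> \<rho>'"
  shows "(A \<longrightarrow> sat S \<rho>') \<and> (\<forall>F K. B F K \<longrightarrow> C F \<longrightarrow> D K \<longrightarrow> fil (E F K) \<rho>')"
  using assms(1) fil.up[OF _ assms(2)] assms(2)[unfolded entails_def] by blast

text \<open>Union elimination adds a variable whose type need not be a basic intersection. The
  valuation of \<open>N\<close> selects one below it, which is why the claim is about an environment
  \<open>H\<close> below \<open>G\<close>. The second half concerns an application with no further
  non-captured application inside: only as a whole can it have its types split, so these are
  generated by applying an arrow true of \<open>F\<close> to a type true of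
  \<open>K\<close>.\<close>

lemma inversion:
  assumes "G \<tturnstile> C \<Ztypecolon> \<rho>" and "\<And>k. binter (H k)" and "\<And>k. H k \<sqsubseteq> G k"
  shows "(\<not> nca C \<longrightarrow> sat (val H C) \<rho>)
    \<and> (\<forall>F K. C = App F K \<longrightarrow> \<not> nca F \<longrightarrow> \<not> nca K \<longrightarrow>
         fil {\<tau>. \<exists>\<sigma>. \<sigma> \<^bold>\<rightarrow> \<tau> \<in> val H F \<and> sat (val H K) \<sigma>} \<rho>)"
  using assms
proof (induction arbitrary: H rule: tp.induct)
  case (Ax G k)
  then have "sat (conj_set (H k)) (G k)" by (meson entails_def order_refl sat_binter)
  then show ?case by simp
next
  case (ArrowI G \<sigma> M \<tau>)
  have "H \<triangleright> \<sigma> \<tturnstile> M \<Ztypecolon> \<tau>"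
    using ArrowI.hyps by (rule tp_env_mono) (use ArrowI.prems in \<open>simp split: nat.split\<close>)
  then show ?case by simp
next
  case (ArrowE G M \<sigma> \<tau> N)
  have "\<sigma> \<^bold>\<rightarrow> \<tau> \<in> val H M" "sat (val H N) \<sigma>" if "\<not> nca M" "\<not> nca N"
    using ArrowE.IH(1)[OF ArrowE.prems] ArrowE.IH(2)[OF ArrowE.prems] that by simp_all
  then show ?case by (auto simp: nca_App intro!: fil.base)
next
  case (InterI G M \<sigma> \<tau>)
  then show ?case by (auto intro: fil.Inter)
next
  case (InterE1 G M \<sigma> \<tau>)
  from InterE1.IH[OF InterE1.prems] show ?case by (rule inversion_up) (simp add: entails_def)
next
  case (InterE2 G M \<sigma> \<tau>)
  from InterE2.IH[OF InterE2.prems] show ?case by (rule inversion_up) (simp add: entails_def)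
next
  case (UnionI1 G M \<sigma> \<tau>)
  from UnionI1.IH[OF UnionI1.prems] show ?case by (rule inversion_up) (simp add: entails_def)
next
  case (UnionI2 G M \<sigma> \<tau>)
  from UnionI2.IH[OF UnionI2.prems] show ?case by (rule inversion_up) (simp add: entails_def)
next
  case (UnionE G \<sigma> \<theta> M \<rho> \<tau> N)
  have split: "\<exists>\<mu>. binter \<mu> \<and> sat (val H N) \<mu> \<and>
      (\<not> nca M \<longrightarrow> sat (val (H \<triangleright> \<mu>) M) \<rho>) \<and>
      (\<forall>F K. M = App F K \<longrightarrow> \<not> nca F \<longrightarrow> \<not> nca K \<longrightarrow>
         fil {\<tau>. \<exists>\<sigma>. \<sigma> \<^bold>\<rightarrow> \<tau> \<in> val (H \<triangleright> \<mu>) F \<and> sat (val (H \<triangleright> \<mu>) K) \<sigma>} \<rho>)"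
    if N: "\<not> nca N"
  proof -
    have "sat (val H N) ((\<sigma> \<^bold>\<or> \<tau>) \<^bold>\<and> \<theta>)" using UnionE.IH(3)[OF UnionE.prems] N by blast
    then obtain \<mu> where \<mu>: "binter \<mu>" "sat (val H N) \<mu>" "\<mu> \<sqsubseteq> \<sigma> \<^bold>\<and> \<theta> \<or> \<mu> \<sqsubseteq> \<tau> \<^bold>\<and> \<theta>"
      by (rule split_valuation)
    have b: "binter ((H \<triangleright> \<mu>) k)" for k using \<mu>(1) UnionE.prems(1) by (simp split: nat.split)
    have le: "(H \<triangleright> \<mu>) k \<sqsubseteq> (G \<triangleright> \<alpha>) k" if "\<mu> \<sqsubseteq> \<alpha>" for \<alpha> k
      using that UnionE.prems(2) by (simp split: nat.split)
    from \<mu>(3) show ?thesis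
    proof
      assume "\<mu> \<sqsubseteq> \<sigma> \<^bold>\<and> \<theta>"
      from UnionE.IH(1)[OF b le[OF this]] \<mu> show ?thesis by blast
    next
      assume "\<mu> \<sqsubseteq> \<tau> \<^bold>\<and> \<theta>"
      from UnionE.IH(2)[OF b le[OF this]] \<mu> show ?thesis by blast
    qed
  qed
  show ?case
  proof (intro conjI allI impI)
    assume C: "\<not> nca (inst M N)"
    then have N: "\<not> nca N" using nca_inst UnionE.hyps by blast
    have M: "\<not> nca M" using C nca_sub by blast
    from split[OF N] M obtain \<mu> where "binter \<mu>" "sat (val H N) \<mu>" "sat (val (H \<triangleright> \<mu>) M) \<rho>" by blast
    with val_inst[OF C _ _ N] show "sat (val H (inst M N)) \<rho>" by (blast intro: sat_mono)
  next
    fix F K assume C: "inst M N = App F K" and F: "\<not> nca F" and K: "\<not> nca K"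
    let ?E = "{\<tau>. \<exists>\<sigma>. \<sigma> \<^bold>\<rightarrow> \<tau> \<in> val H F \<and> sat (val H K) \<sigma>}"
    from C show "fil ?E \<rho>"
    proof (cases rule: inst_eq_App)
      case 1
      \<comment> \<open>The whole application is the eliminated term: both branches type a mere
        variable, so the union is only weakened.\<close>
      then have "fil ?E ((\<sigma> \<^bold>\<or> \<tau>) \<^bold>\<and> \<theta>)" using UnionE.IH(3)[OF UnionE.prems] C F K by simp
      moreover have "\<sigma> \<^bold>\<and> \<theta> \<sqsubseteq> \<rho>" "\<tau> \<^bold>\<and> \<theta> \<sqsubseteq> \<rho>"
        using UnionE.hyps(1,2) 1 by (simp_all add: tp_Var_iff)
      ultimately show ?thesis by (elim fil.up) (auto simp: entails_def)
    next
      case (2 F' K')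
      \<comment> \<open>Here \<open>N\<close> lies inside \<open>F\<close> or \<open>K\<close>, so
        its own valuation decides between the branches.\<close>
      have N: "\<not> nca N"
        using UnionE.hyps(4) F K unfolding 2 by (elim occ_App_1) (metis nca_inst)+
      have "\<not> nca F'" "\<not> nca K'" using F K 2 nca_sub by blast+
      with split[OF N] 2 obtain \<mu> where \<mu>: "binter \<mu>" "sat (val H N) \<mu>"
        "fil {\<tau>. \<exists>\<sigma>. \<sigma> \<^bold>\<rightarrow> \<tau> \<in> val (H \<triangleright> \<mu>) F' \<and> sat (val (H \<triangleright> \<mu>) K') \<sigma>} \<rho>" by blast
      have "val (H \<triangleright> \<mu>) F' \<subseteq> val H F" "val (H \<triangleright> \<mu>) K' \<subseteq> val H K"
        using val_inst[OF _ \<mu>(1,2) N] F K 2 by simp_all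
      then show ?thesis by (intro fil_mono[OF \<mu>(3)]) (blast intro: sat_mono)
    qed
  qed
qed

lemma tp_val:
  assumes "G \<tturnstile> M \<Ztypecolon> \<tau>" "\<And>k. binter (G k)" "\<not> nca M"
  shows "sat (val G M) \<tau>"
  using inversion[OF assms(1,2)] assms(3) by simp

lemma tp_App_fil:
  assumes "G \<tturnstile> App F K \<Ztypecolon> \<rho>" "\<And>k. binter (G k)" "\<not> nca F" "\<not> nca K"
  shows "fil {\<tau>. \<exists>\<sigma>. \<sigma> \<^bold>\<rightarrow> \<tau> \<in> val G F \<and> sat (val G K) \<sigma>} \<rho>"
  using inversion[OF assms(1,2)] assms(3,4) by simp

text \<open>For a minimal redex the types are generated by those \<beta> for which the abstraction
  has the type \<open>\<alpha> \<rightarrow> \<beta>\<close> and \<open>\<alpha>\<close> is true of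
  \<open>K\<close>; a cut gives each such \<beta> to the contractum.\<close>

lemma tp_contract:
  assumes "G \<tturnstile> inst M (App (Lam B) K) \<Ztypecolon> \<tau>" and "\<And>k. binter (G k)"
    and "lin M" "occ 0 M = 1" and "\<not> nca (Lam B)" "\<not> nca K"
  shows "G \<tturnstile> inst M (inst B K) \<Ztypecolon> \<tau>"
proof -
  obtain \<rho> where \<rho>: "G \<tturnstile> App (Lam B) K \<Ztypecolon> \<rho>" "G \<triangleright> \<rho> \<tturnstile> M \<Ztypecolon> \<tau>"
    using tp_inst_decompose[OF assms(1,3,4)] .
  have "G \<tturnstile> inst B K \<Ztypecolon> \<rho>"
    using tp_App_fil[OF \<rho>(1) assms(2,5,6)]
  proof (rule tp_fil)
    fix \<beta> assume "\<beta> \<in> {\<tau>. \<exists>\<sigma>. \<sigma> \<^bold>\<rightarrow> \<tau> \<in> val G (Lam B) \<and> sat (val G K) \<sigma>}"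
    then obtain \<alpha> where "G \<triangleright> \<alpha> \<tturnstile> B \<Ztypecolon> \<beta>" "sat (val G K) \<alpha>" by auto
    then show "G \<tturnstile> inst B K \<Ztypecolon> \<beta>" using assms(6) by (blast intro: tp_cut val_tp)
  qed
  with \<rho>(2) show ?thesis by (rule tp_cut)
qed

section \<open>Confluence and normal forms\<close>

inductive par :: "trm \<Rightarrow> trm \<Rightarrow> bool"  (infix "\<Rrightarrow>" 50) where
  Var: "Var i \<Rrightarrow> Var i"
| App: "M \<Rrightarrow> M' \<Longrightarrow> N \<Rrightarrow> N' \<Longrightarrow> App M N \<Rrightarrow> App M' N'"
| Lam: "M \<Rrightarrow> M' \<Longrightarrow> Lam M \<Rrightarrow> Lam M'"
| beta: "M \<Rrightarrow> M' \<Longrightarrow> N \<Rrightarrow> N' \<Longrightarrow> App (Lam M) N \<Rrightarrow> inst M' N'"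

abbreviation pars :: "trm \<Rightarrow> trm \<Rightarrow> bool"  (infix "\<Rrightarrow>\<^sup>*" 50) where
  "M \<Rrightarrow>\<^sup>* N \<equiv> par\<^sup>*\<^sup>* M N"

text \<open>Takahashi's complete development: every parallel reduct of \<open>M\<close> reaches
  \<open>dev M\<close> in one further parallel step.\<close>

fun dev :: "trm \<Rightarrow> trm" where
  "dev (Var i) = Var i"
| "dev (Lam M) = Lam (dev M)"
| "dev (App (Lam M) N) = inst (dev M) (dev N)"
| "dev (App M N) = App (dev M) (dev N)"

lemma par_refl [simp]: "M \<Rrightarrow> M"
  by (induction M) (auto intro: par.intros)

lemma par_ren: "M \<Rrightarrow> M' \<Longrightarrow> ren f M \<Rrightarrow> ren f M'"
  by (induction arbitrary: f rule: par.induct) (auto simp: ren_inst intro: par.intros)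

lemma par_sub: "M \<Rrightarrow> M' \<Longrightarrow> (\<And>i. s i \<Rrightarrow> s' i) \<Longrightarrow> sub s M \<Rrightarrow> sub s' M'"
proof (induction arbitrary: s s' rule: par.induct)
  case (Lam M M')
  have "up s i \<Rrightarrow> up s' i" for i using Lam.prems by (cases i) (simp_all add: par_ren)
  from Lam.IH[OF this] show ?case by (simp add: par.Lam)
next
  case (beta M M' N N')
  have "up s i \<Rrightarrow> up s' i" for i using beta.prems by (cases i) (simp_all add: par_ren)
  from par.beta[OF beta.IH(1)[OF this] beta.IH(2)[OF beta.prems]] show ?case
    by (simp add: sub_inst_up)
qed (auto intro: par.intros)

lemma par_inst: "M \<Rrightarrow> M' \<Longrightarrow> N \<Rrightarrow> N' \<Longrightarrow> inst M N \<Rrightarrow> inst M' N'"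
  by (rule par_sub) (auto split: nat.split)

inductive_cases par_LamE: "Lam M \<Rrightarrow> N"
inductive_cases par_AppE: "App M N \<Rrightarrow> X"
inductive_cases par_VarE: "Var i \<Rrightarrow> X"

lemma par_dev: "M \<Rrightarrow> N \<Longrightarrow> N \<Rrightarrow> dev M"
proof (induction M arbitrary: N rule: dev.induct)
  case (3 M L)
  from 3(3) show ?case
    by (rule par_AppE) (auto elim!: par_LamE intro!: par.beta par_inst 3 simp: dev.simps)
qed (auto elim!: par_VarE par_LamE par_AppE intro!: par.intros)

lemma diamond_strip: "M \<Rrightarrow>\<^sup>* N \<Longrightarrow> M \<Rrightarrow> L \<Longrightarrow> \<exists>X. N \<Rrightarrow> X \<and> L \<Rrightarrow>\<^sup>* X"
proof (induction rule: rtranclp_induct)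
  case (step N N')
  then obtain X where "N \<Rrightarrow> X" "L \<Rrightarrow>\<^sup>* X" by blast
  with step.hyps(2) have "N' \<Rrightarrow> dev N" "X \<Rrightarrow> dev N" by (simp_all add: par_dev)
  with \<open>L \<Rrightarrow>\<^sup>* X\<close> show ?case by (meson rtranclp.rtrancl_into_rtrancl)
qed blast

lemma pars_confluent: "M \<Rrightarrow>\<^sup>* L \<Longrightarrow> M \<Rrightarrow>\<^sup>* N \<Longrightarrow> \<exists>X. N \<Rrightarrow>\<^sup>* X \<and> L \<Rrightarrow>\<^sup>* X"
proof (induction rule: rtranclp_induct)
  case (step L L')
  then obtain X where "N \<Rrightarrow>\<^sup>* X" "L \<Rrightarrow>\<^sup>* X" by blast
  with diamond_strip step.hyps(2) obtain Y where "X \<Rrightarrow> Y" "L' \<Rrightarrow>\<^sup>* Y" by blast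
  with \<open>N \<Rrightarrow>\<^sup>* X\<close> show ?case by (meson rtranclp.rtrancl_into_rtrancl)
qed blast

lemma beta_par: "M \<rightarrow>\<^sub>\<beta> N \<Longrightarrow> M \<Rrightarrow> N"
  by (induction rule: beta.induct) (auto simp: subst_inst intro: par.intros)

section \<open>Normal forms, and normalisation of linear terms\<close>

fun nf :: "trm \<Rightarrow> bool" where
  "nf (Var i) = True"
| "nf (Lam M) = nf M"
| "nf (App (Lam M) N) = False"
| "nf (App M N) = (nf M \<and> nf N)"

lemma nf_par: "nf M \<Longrightarrow> M \<Rrightarrow> N \<Longrightarrow> N = M"
proof (induction M arbitrary: N rule: nf.induct)
  case ("4_2" M1 M2 L)
  from "4_2"(4) obtain X Y where "N = App X Y" "App M1 M2 \<Rrightarrow> X" "L \<Rrightarrow> Y"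
    by (rule par_AppE) simp_all
  with "4_2" show ?case by simp
qed (auto elim!: par_VarE par_LamE par_AppE)

lemma nf_pars: "M \<Rrightarrow>\<^sup>* N \<Longrightarrow> nf M \<Longrightarrow> N = M"
  by (induction rule: rtranclp_induct) (auto dest: nf_par)

lemma conv_nf:
  assumes "M =\<^sub>\<beta> N" and "nf N"
  shows "M \<Rrightarrow>\<^sup>* N"
proof -
  have "\<exists>X. M \<Rrightarrow>\<^sup>* X \<and> N \<Rrightarrow>\<^sup>* X" using assms(1)
  proof (induction rule: equivclp_induct)
    case base
    then show ?case by blast
  next
    case (step y z)
    then obtain X where X: "M \<Rrightarrow>\<^sup>* X" "y \<Rrightarrow>\<^sup>* X" by blast
    from step.hyps(2) consider "y \<Rrightarrow> z" | "z \<Rrightarrow> y" by (auto dest: beta_par)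
    then show ?case
    proof cases
      case 1
      with X(2) diamond_strip obtain Y where "X \<Rrightarrow> Y" "z \<Rrightarrow>\<^sup>* Y" by blast
      with X(1) show ?thesis by (meson rtranclp.rtrancl_into_rtrancl)
    next
      case 2
      with X show ?thesis by (meson converse_rtranclp_into_rtranclp)
    qed
  qed
  with nf_pars assms(2) show ?thesis by blast
qed

lemma pars_nf: "M \<Rrightarrow>\<^sup>* N \<Longrightarrow> nf N \<Longrightarrow> M \<Rrightarrow>\<^sup>* M' \<Longrightarrow> M' \<Rrightarrow>\<^sup>* N"
  using pars_confluent nf_pars by metis

lemma Lam_pars: "Lam M \<Rrightarrow>\<^sup>* N \<Longrightarrow> \<exists>M'. N = Lam M' \<and> M \<Rrightarrow>\<^sup>* M'"
  by (induction rule: rtranclp_induct)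
    (auto elim!: par_LamE intro: rtranclp.rtrancl_into_rtrancl)

lemma pars_App: "M \<Rrightarrow>\<^sup>* M' \<Longrightarrow> N \<Rrightarrow>\<^sup>* N' \<Longrightarrow> App M N \<Rrightarrow>\<^sup>* App M' N'"
proof (induction rule: rtranclp_induct)
  case base
  from base.prems show ?case
    by (induction rule: rtranclp_induct)
      (simp, erule rtranclp.rtrancl_into_rtrancl, simp add: par.App)
next
  case (step L L')
  then have "App M N \<Rrightarrow>\<^sup>* App L N'" by blast
  moreover have "App L N' \<Rrightarrow> App L' N'" using step.hyps(2) by (simp add: par.App)
  ultimately show ?case by (rule rtranclp.rtrancl_into_rtrancl)
qed

lemma pars_inst: "M \<Rrightarrow>\<^sup>* M' \<Longrightarrow> N \<Rrightarrow>\<^sup>* N' \<Longrightarrow> inst M N \<Rrightarrow>\<^sup>* inst M' N'"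
proof (induction rule: rtranclp_induct)
  case base
  from base.prems show ?case
    by (induction rule: rtranclp_induct)
      (simp, erule rtranclp.rtrancl_into_rtrancl, simp add: par_inst)
next
  case (step L L')
  then have "inst M N \<Rrightarrow>\<^sup>* inst L N'" by blast
  moreover have "inst L N' \<Rrightarrow> inst L' N'" using step.hyps(2) by (simp add: par_inst)
  ultimately show ?case by (rule rtranclp.rtrancl_into_rtrancl)
qed

lemma nf_ren [simp]: "nf (ren f M) = nf M"
  by (induction M arbitrary: f rule: nf.induct) auto

text \<open>No substituted term is an abstraction, so no redex is created; this property of the
  substitution survives \<open>up\<close>.\<close>

lemma nf_inst_neutral:
  assumes "nf M" and "nf K"
  shows "nf (inst M (App (Var z) K))"
proof -
  have "nf (sub s M)" if "\<And>i. nf (s i)" "\<And>i L. s i \<noteq> Lam L" "nf M" for s M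
    using that
  proof (induction M arbitrary: s rule: nf.induct)
    case (2 M)
    have "nf (up s i)" "up s i \<noteq> Lam L" for i L
    proof -
      show "nf (up s i)" using 2 by (cases i) simp_all
      show "up s i \<noteq> Lam L"
      proof (cases i)
        case (Suc j)
        then show ?thesis using 2(3)[of j] by (cases "s j") auto
      qed simp
    qed
    with 2 show ?case by simp
  next
    case ("4_1" i N)
    have "nf (s i)" "nf (sub s N)" using "4_1" by simp_all
    then show ?case using "4_1.prems"(2) by (cases "s i") auto
  next
    case ("4_2" M1 M2 N)
    then show ?case by auto
  qed simp_all
  from this[of "case_nat (App (Var z) K) Var" M] assms show ?thesis by (simp split: nat.split)
qed

text \<open>Contracting a linear redex places its argument exactly once, so the term shrinks and all
  occurrence counts persist.\<close>

lemma lin_nf: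
  "lin M \<Longrightarrow> \<exists>N. M \<Rrightarrow>\<^sup>* N \<and> nf N \<and> (\<forall>k. occ k N = occ k M)"
proof -
  have step: "\<exists>M'. M \<Rrightarrow> M' \<and> lin M' \<and> (\<forall>k. occ k M' = occ k M) \<and> size M' < size M"
    if "lin M" "\<not> nf M" for M
    using that
  proof (induction M rule: nf.induct)
    case (2 M)
    then obtain M' where "M \<Rrightarrow> M'" "lin M'" "\<forall>k. occ k M' = occ k M" "size M' < size M"
      by (auto simp: lin_Lam)
    then show ?case using 2 by (intro exI[of _ "Lam M'"]) (simp add: lin_Lam par.Lam)
  next
    case (3 M N)
    then have l: "lin M" "occ 0 M = 1" "lin N" "\<forall>k. occ (Suc k) M = 0 \<or> occ k N = 0"
      by (simp_all add: lin_Lam)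
    have "App (Lam M) N \<Rrightarrow> inst M N" by (simp add: par.beta)
    then show ?case using l by (intro exI[of _ "inst M N"]) (simp add: lin_inst occ_inst size_inst)
  next
    case ("4_1" i N)
    then obtain N' where "N \<Rrightarrow> N'" "lin N'" "\<forall>k. occ k N' = occ k N" "size N' < size N" by auto
    then show ?case using "4_1" by (intro exI[of _ "App (Var i) N'"]) (simp add: par.App)
  next
    case ("4_2" M1 M2 N)
    then have l: "lin (App M1 M2)" "lin N" by simp_all
    show ?case
    proof (cases "nf (App M1 M2)")
      case True
      then obtain N' where "N \<Rrightarrow> N'" "lin N'" "\<forall>k. occ k N' = occ k N" "size N' < size N"
        using "4_2" l by auto
      then show ?thesis using "4_2"(3) by (intro exI[of _ "App (App M1 M2) N'"]) (simp add: par.App)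
    next
      case False
      then obtain M' where "App M1 M2 \<Rrightarrow> M'" "lin M'" "\<forall>k. occ k M' = occ k (App M1 M2)"
        "size M' < size (App M1 M2)"
        using "4_2" l by blast
      then show ?thesis using "4_2"(3) by (intro exI[of _ "App M' N"]) (simp add: par.App)
    qed
  qed simp
  show "\<exists>N. M \<Rrightarrow>\<^sup>* N \<and> nf N \<and> (\<forall>k. occ k N = occ k M)" if "lin M"
    using that
  proof (induction "size M" arbitrary: M rule: less_induct)
    case less
    show ?case
    proof (cases "nf M")
      case False
      then obtain M' where M': "M \<Rrightarrow> M'" "lin M'" "\<forall>k. occ k M' = occ k M" "size M' < size M"
        using step less.prems by blast
      then obtain N where "M' \<Rrightarrow>\<^sup>* N" "nf N" "\<forall>k. occ k N = occ k M'" using less.hyps by blast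
      with M' show ?thesis by (metis converse_rtranclp_into_rtranclp)
    qed blast
  qed
qed

section \<open>Terms with a distinguished head variable\<close>

fun spine :: "nat \<Rightarrow> trm \<Rightarrow> bool" where
  "spine k (Var i) = (i = k)"
| "spine k (App F K) = (spine k F \<and> \<not> nca K)"
| "spine k (Lam M) = False"

fun headed :: "nat \<Rightarrow> trm \<Rightarrow> bool" where
  "headed k (Lam M) = headed (Suc k) M"
| "headed k M = spine k M"

lemma nca_hole:
  assumes "occ d M = 1"
  shows "nca (sub (hole d (App F K)) M)"
proof -
  \<comment> \<open>The hole moves to the front. Indices above \<open>d\<close> stay, because both
    substitutions decrement them.\<close>
  let ?r = "\<lambda>i. if i < d then Suc i else if i = d then 0 else i"
  let ?R = "App (ren (\<lambda>j. j + d) F) (ren (\<lambda>j. j + d) K)"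
  have "sub (hole d (App F K)) M = inst (ren ?r M) ?R"
    unfolding sub_ren by (rule sub_cong) (auto simp: upn_def split: nat.split)
  moreover have "occ 0 (ren ?r M) = 1"
    using occ_sub1[of 0 "\<lambda>i. Var (?r i)" d 1 M] assms by (auto simp: ren_sub)
  ultimately show ?thesis unfolding nca_def by blast
qed

text \<open>A hole inside an argument would make that argument contain a non-captured application.
  So the hole is the head, and filling it makes \<open>z\<close> the head.\<close>

lemma spine_hole:
  "spine (k + d) (sub (hole d (App (Var z) K)) M) \<Longrightarrow> occ d M = 1 \<Longrightarrow> z = k \<and> spine d M"
proof (induction M)
  case (Var i)
  then show ?case by (auto simp: upn_def split: if_splits)
next
  case (App F L)
  have "occ d L \<noteq> 1" using App.prems(1) nca_hole by auto
  with App.prems(2) have "occ d F = 1" by auto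
  with App show ?case using nca_sub by auto
qed simp

lemma spine_headed: "spine k M \<Longrightarrow> headed k M"
  by (cases M) auto

lemma headed_hole:
  "headed (k + d) (sub (hole d (App (Var z) K)) M) \<Longrightarrow> occ d M = 1 \<Longrightarrow> z = k \<and> headed d M"
proof (induction M arbitrary: d)
  case (Var i)
  then have "i = d" by (simp split: if_splits)
  with Var show ?case by (simp add: upn_def)
next
  case (App F L)
  then have "spine (k + d) (sub (hole d (App (Var z) K)) (App F L))" by simp
  from spine_hole[OF this App.prems(2)] show ?case by (blast intro: spine_headed)
next
  case (Lam M)
  from Lam.IH[of "Suc d"] Lam.prems show ?case by (simp add: up_upn)
qed

lemma headed_inst:
  "headed k (inst M (App (Var z) K)) \<Longrightarrow> occ 0 M = 1 \<Longrightarrow> z = k \<and> headed 0 M"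
  using headed_hole[of k 0] by simp

lemma w_basic_union: "basic_union \<chi> \<Longrightarrow> w \<chi> = \<chi>"
proof (induction \<chi>)
  case (Union \<sigma> \<tau>)
  then show ?case by simp
qed auto

lemma case_nat_upd_0: "(G \<triangleright> \<sigma>)(0 := \<tau>) = G \<triangleright> \<tau>"
  by (rule ext) (simp split: nat.split)

lemma case_nat_upd_Suc: "(G \<triangleright> \<sigma>)(Suc k := \<tau>) = G(k := \<tau>) \<triangleright> \<sigma>"
  by (rule ext) (simp split: nat.split)

text \<open>The types \<open>b\<close> of the head variable which do not give type \<open>\<kappa>\<close> to the term form a valuation.
  If no component of \<open>cw \<sigma>\<close> gave it type \<open>\<kappa>\<close>, this valuation would satisfy \<open>cw \<sigma>\<close>, and then
  the basic intersection of \<open>w \<sigma>\<close> that it selects leads to a contradiction.\<close>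

lemma headed_cw:
  assumes "lin A" "A \<Rrightarrow>\<^sup>* N" "nf N" "headed k N" "occ k A = 1" "\<And>i. binter (G i)"
    and "G(k := \<sigma>) \<tturnstile> A \<Ztypecolon> \<tau>" "\<kappa> \<in> conj_set (cw \<tau>)"
  shows "\<exists>\<chi>\<in>conj_set (cw \<sigma>). G(k := \<chi>) \<tturnstile> A \<Ztypecolon> \<kappa>"
  using assms
proof (induction "size A" arbitrary: A N k G \<sigma> \<tau> \<kappa> rule: less_induct)
  case less
  note lin_A = less.prems(1) and A_N = less.prems(2) and nf_N = less.prems(3)
    and headed_N = less.prems(4) and occ_A = less.prems(5) and G = less.prems(6)
    and A = less.prems(7) and \<kappa> = less.prems(8)
  define B where "B = {b. basic b \<and> \<not> G(k := b) \<tturnstile> A \<Ztypecolon> \<kappa>}"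
  have basic_\<kappa>: "basic_union \<kappa>" using \<kappa> by (rule cw_basic_union)
  show ?case
  proof (rule ccontr)
    assume none: "\<not> ?thesis"
    have "sat B (cw \<sigma>)"
      unfolding sat_conj_set[of B "cw \<sigma>"]
    proof
      fix \<chi> assume \<chi>: "\<chi> \<in> conj_set (cw \<sigma>)"
      then have u: "basic_union \<chi>" by (rule cw_basic_union)
      \<comment> \<open>Otherwise union elimination on the head variable would combine the typings
        for the members into one for \<open>\<chi>\<close>.\<close>
      have "\<exists>b\<in>disj_set \<chi>. \<not> G(k := b) \<tturnstile> A \<Ztypecolon> \<kappa>"
        using tp_split[OF occ_A, of \<chi> G \<kappa>] none \<chi> by (auto simp: w_basic_union[OF u])
      then show "sat B \<chi>" using u by (auto simp: sat_basic_union B_def basic_union_disj_set)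
    qed
    \<comment> \<open>The pullback of \<open>B\<close> satisfies \<open>\<sigma>\<close> and selects
      a basic intersection \<open>p\<close> of \<open>w \<sigma>\<close>. All components of
      \<open>cw p\<close> then lie in \<open>B\<close>.\<close>
    then obtain p where p: "p \<in> disj_set (w \<sigma>)" "sat (cw_core B) p"
      unfolding sat_cw using sat_w by blast
    then have binter_p: "binter p" by (blast intro: w_binter)
    have "p \<sqsubseteq> \<sigma>" using p(1) sat_w[of _ \<sigma>] by (auto simp: entails_def)
    with A have Ap: "G(k := p) \<tturnstile> A \<Ztypecolon> \<tau>" by (elim tp_env_mono) simp
    have Gp: "binter ((G(k := p)) i)" for i using G binter_p by simp
    have cw_p: "\<chi> \<in> B" if "\<chi> \<in> conj_set (cw \<alpha>)" "\<alpha> \<in> conj_set p" for \<chi> \<alpha>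
    proof -
      have "basic \<alpha>" "\<alpha> \<in> cw_core B"
        using that(2) binter_p p(2) by (auto simp: binter_conj_set sat_binter)
      then have "basic \<chi>" "sat B \<chi>"
        using that(1) cw_basic sat_conj_set[of B "cw \<alpha>"] by (auto simp: cw_core_def)
      then show ?thesis by (simp add: sat_basic)
    qed
    have cw_p': "\<chi> \<in> B" if "\<chi> \<in> conj_set (cw p)" for \<chi>
      using that cw_p by (auto simp: conj_set_cw_binter[OF binter_p])
    have contra: False if "b \<in> B" "G(k := b) \<tturnstile> A \<Ztypecolon> \<kappa>" for b
      using that by (simp add: B_def)
    show False
    proof (cases "nca A")
      case True
      then obtain A0 F K where A0: "occ 0 A0 = 1" "A = inst A0 (App F K)"
        and nF: "\<not> nca F" and nK: "\<not> nca K" by (rule nca_minimal)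
      have l: "lin A0" "lin F" "lin K" "\<And>i. occ i F = 0 \<or> occ i K = 0"
        "\<And>i. occ (Suc i) A0 = 0 \<or> occ i (App F K) = 0"
        using lin_A A0 by (simp_all add: lin_inst)
      show False
      proof (cases F)
        case (Var z)
        \<comment> \<open>Putting a normal \<open>z K'\<close> into a normal context creates no
          redex, so normalising \<open>A0\<close> and \<open>K\<close> separately yields
          \<open>N\<close>; its shape identifies \<open>z\<close> with the head
          \<open>k\<close>.\<close>
        obtain N0 where N0: "A0 \<Rrightarrow>\<^sup>* N0" "nf N0" "\<forall>i. occ i N0 = occ i A0"
          using lin_nf[OF l(1)] by blast
        obtain K' where K': "K \<Rrightarrow>\<^sup>* K'" "nf K'" using lin_nf[OF l(3)] by blast
        have "A \<Rrightarrow>\<^sup>* inst N0 (App (Var z) K')"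
          unfolding A0(2) Var by (intro pars_inst pars_App N0 K') simp
        from pars_nf[OF A_N nf_N this] have "N = inst N0 (App (Var z) K')"
          using nf_pars nf_inst_neutral N0(2) K'(2) by blast
        with headed_N have z: "z = k" and hd: "headed 0 N0"
          using headed_inst[of k z K' N0] N0(3) A0(1) by simp_all
        have "G(k := p) \<tturnstile> inst A0 (App (Var k) K) \<Ztypecolon> \<tau>" using Ap A0(2) Var z by simp
        then obtain \<rho> where \<rho>: "G(k := p) \<tturnstile> App (Var k) K \<Ztypecolon> \<rho>" "G(k := p) \<triangleright> \<rho> \<tturnstile> A0 \<Ztypecolon> \<tau>"
          by (rule tp_inst_decompose[OF _ l(1) A0(1)])
        have "fil {\<gamma>. \<exists>\<alpha>. \<alpha> \<^bold>\<rightarrow> \<gamma> \<in> conj_set p \<and> sat (val (G(k := p)) K) \<alpha>} \<rho>"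
        proof -
          have "\<not> nca (Var k)" using nF Var z by simp
          from tp_App_fil[OF \<rho>(1) _ this nK] Gp show ?thesis by (simp del: fun_upd_apply) simp
        qed
        then obtain xs where xs: "xs \<noteq> []" "Inters xs \<sqsubseteq> \<rho>"
          "set xs \<subseteq> {\<gamma>. \<exists>\<alpha>. \<alpha> \<^bold>\<rightarrow> \<gamma> \<in> conj_set p \<and> sat (val (G(k := p)) K) \<alpha>}"
          by (rule fil_Inters)
        \<comment> \<open>Index \<open>0\<close> of \<open>A0\<close> stands for the head with its
          first argument and is the new head variable. The type \<open>p\<close> stored there is a
          placeholder that the update overwrites.\<close>
        have "\<exists>\<chi>\<in>conj_set (cw (Inters xs)). (G(k := p) \<triangleright> p)(0 := \<chi>) \<tturnstile> A0 \<Ztypecolon> \<kappa>"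
        proof (rule less.hyps[OF _ l(1) N0(1,2) hd A0(1)])
          show "size A0 < size A" using A0 by (simp add: size_inst)
          show "(G(k := p) \<triangleright> p)(0 := Inters xs) \<tturnstile> A0 \<Ztypecolon> \<tau>" unfolding case_nat_upd_0
            using \<rho>(2) by (rule tp_env_mono) (simp add: xs(2) split: nat.split)
          show "binter ((G(k := p) \<triangleright> p) i)" for i
            using Gp binter_p by (simp split: nat.split)
        qed (fact \<kappa>)
        then obtain \<chi> \<gamma> where \<chi>: "\<gamma> \<in> set xs" "\<chi> \<in> conj_set (cw \<gamma>)" "G(k := p) \<triangleright> \<chi> \<tturnstile> A0 \<Ztypecolon> \<kappa>"
          unfolding case_nat_upd_0 conj_set_cw_Inters[OF xs(1)] by blast
        then obtain \<alpha> where \<alpha>: "\<alpha> \<^bold>\<rightarrow> \<gamma> \<in> conj_set p" "sat (val (G(k := p)) K) \<alpha>" using xs(3) by blast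
        then obtain \<mu> where \<mu>: "\<mu> \<in> disj_set (w \<alpha>)" "sat (val (G(k := p)) K) \<mu>" using sat_w by blast
        \<comment> \<open>\<open>\<chi>\<close> comes from the induction hypothesis and
          \<open>\<mu>\<close> is the member of \<open>w \<alpha>\<close> true of \<open>K\<close>,
          so the arrow is a component of \<open>cw\<close> of a conjunct of \<open>p\<close> and
          lies in \<open>B\<close>. By linearity \<open>k\<close> occurs neither in \<open>K\<close>
          nor in \<open>A0\<close>, so their typings survive the change of its type.\<close>
        let ?b = "\<mu> \<^bold>\<rightarrow> \<chi>"
        have "?b \<in> conj_set (cw (\<alpha> \<^bold>\<rightarrow> \<gamma>))" unfolding conj_set_cw_Arrow using \<mu>(1) \<chi>(2) by blast
        then have "?b \<in> B" using \<alpha>(1) by (rule cw_p)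
        moreover have "G(k := ?b) \<tturnstile> A \<Ztypecolon> \<kappa>"
          unfolding A0(2)
        proof (rule tp_cut)
          have "occ k K = 0" using l(4)[of k] Var z by simp
          with val_tp[OF \<mu>(2) nK] have "G(k := ?b) \<tturnstile> K \<Ztypecolon> \<mu>" by (elim tp_cong) auto
          moreover have "G(k := ?b) \<tturnstile> F \<Ztypecolon> ?b" using Var z by (simp add: tp_Var_iff)
          ultimately show "G(k := ?b) \<tturnstile> App F K \<Ztypecolon> \<chi>" by (blast intro: tp.ArrowE)
          have "occ (Suc k) A0 = 0" using l(5)[of k] Var z by simp
          with \<chi>(3) show "G(k := ?b) \<triangleright> \<chi> \<tturnstile> A0 \<Ztypecolon> \<kappa>"
            by (elim tp_cong) (auto split: nat.split)
        qed
        ultimately show False by (rule contra)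
      next
        case (App F1 F2)
        with nF show False by (simp add: nca_App)
      next
        case (Lam L)
        let ?A = "inst A0 (inst L K)"
        have L: "lin L" "occ 0 L = 1" using l(2) Lam by (simp_all add: lin_Lam)
        have occ: "occ i (inst L K) = occ i (App F K)" for i using L Lam by (simp add: occ_inst)
        have "lin (inst L K)" using l(3,4) L Lam by (simp add: lin_inst)
        then have "lin ?A" using A0(1) l(1,5) by (simp add: lin_inst occ)
        moreover have "A \<Rrightarrow> ?A" unfolding A0(2) Lam by (intro par_inst par.beta) simp_all
        then have "?A \<Rrightarrow>\<^sup>* N" using pars_nf[OF A_N nf_N] by blast
        moreover have "size ?A < size A" using A0 L Lam by (simp add: size_inst)
        moreover have "occ k ?A = 1" using occ_A A0 by (simp add: occ_inst[where M = A0] occ)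
        moreover have "G(k := p) \<tturnstile> ?A \<Ztypecolon> \<tau>"
          by (rule tp_contract) (use Ap A0 Gp l nF nK Lam in auto)
        \<comment> \<open>Contraction needs basic intersections in the environment, so the head has
          type \<open>p\<close> here. Any component of \<open>cw p\<close> lies in \<open>B\<close>,
          which suffices after expanding the redex back.\<close>
        ultimately obtain \<chi> where \<chi>: "\<chi> \<in> conj_set (cw p)" "G(k := \<chi>) \<tturnstile> ?A \<Ztypecolon> \<kappa>"
          using less.hyps[of ?A N k G p \<tau> \<kappa>] nf_N headed_N G \<kappa> by blast
        have "G(k := \<chi>) \<tturnstile> A \<Ztypecolon> \<kappa>"
          unfolding A0(2) Lam using \<chi>(2) l(1) A0(1) L by (rule tp_expand)
        with \<chi>(1) show False using cw_p' contra by blast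
      qed
    next
      case nA: False
      show False
      proof (cases A)
        case (Var i)
        with occ_A have i: "i = k" by (simp split: if_splits)
        \<comment> \<open>The term is the head itself: the pullback of \<open>B\<close> satisfies
          \<open>p\<close>, hence \<open>\<tau>\<close>, so \<open>B\<close> contains a member of
          \<open>\<kappa>\<close>, and that member does give type \<open>\<kappa>\<close>.\<close>
        have "p \<sqsubseteq> \<tau>" using Ap Var i by (simp add: tp_Var_iff)
        with p(2) have "sat B (cw \<tau>)" by (simp add: sat_cw entails_def)
        with \<kappa> have "sat B \<kappa>" using sat_conj_set by blast
        then obtain b where b: "b \<in> disj_set \<kappa>" "b \<in> B" using basic_\<kappa> by (auto simp: sat_basic_union)
        have "b \<sqsubseteq> \<kappa>" unfolding entails_def using b(1) sat_disj_set by blast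
        then have "G(k := b) \<tturnstile> A \<Ztypecolon> \<kappa>" using Var i by (simp add: tp_Var_iff)
        with b(2) show False by (rule contra)
      next
        case (App F K)
        with nA show False by (simp add: nca_App)
      next
        case (Lam C)
        obtain N1 where N1: "N = Lam N1" "C \<Rrightarrow>\<^sup>* N1" using Lam_pars A_N Lam by blast
        \<comment> \<open>The arrows obtained from types in \<open>B\<close>. By the induction
          hypothesis for \<open>C\<close>, the components of \<open>cw\<close> of every arrow of
          \<open>A\<close> under \<open>p\<close> lie in \<open>V\<close>. The witness
          \<open>b\<close> may vary with the arrow, which is harmless: finally a single member of
          \<open>\<kappa>\<close> in \<open>V\<close> is used.\<close>
        define V where "V = {\<mu> \<^bold>\<rightarrow> \<kappa>' |\<mu> \<kappa>'. \<exists>b\<in>B. G(k := b) \<triangleright> \<mu> \<tturnstile> C \<Ztypecolon> \<kappa>'}"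
        have "val (G(k := p)) A \<subseteq> cw_core V"
        proof
          fix \<delta> assume "\<delta> \<in> val (G(k := p)) A"
          then obtain \<sigma>' \<tau>' where \<delta>: "\<delta> = \<sigma>' \<^bold>\<rightarrow> \<tau>'" "G(k := p) \<triangleright> \<sigma>' \<tturnstile> C \<Ztypecolon> \<tau>'"
            unfolding Lam by auto
          have "\<mu> \<^bold>\<rightarrow> \<kappa>' \<in> V" if "\<mu> \<in> disj_set (w \<sigma>')" "\<kappa>' \<in> conj_set (cw \<tau>')" for \<mu> \<kappa>'
          proof -
            have "\<exists>\<chi>\<in>conj_set (cw p). (G \<triangleright> \<mu>)(Suc k := \<chi>) \<tturnstile> C \<Ztypecolon> \<kappa>'"
            proof (rule less.hyps[OF _ _ N1(2)])
              show "size C < size A" "lin C" "occ (Suc k) C = 1"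
                using Lam lin_A occ_A by (simp_all add: lin_Lam)
              show "nf N1" "headed (Suc k) N1" using nf_N headed_N N1 by simp_all
              show "binter ((G \<triangleright> \<mu>) i)" for i
                using G that(1) by (auto split: nat.split intro: w_binter)
              have "\<mu> \<sqsubseteq> \<sigma>'" using that(1) sat_w[of _ \<sigma>'] by (auto simp: entails_def)
              with \<delta>(2) show "(G \<triangleright> \<mu>)(Suc k := p) \<tturnstile> C \<Ztypecolon> \<tau>'" unfolding case_nat_upd_Suc
                by (elim tp_env_mono) (simp split: nat.split)
            qed (fact that(2))
            then show ?thesis unfolding V_def case_nat_upd_Suc using cw_p' by blast
          qed
          then have "sat V (cw \<delta>)"
            unfolding \<delta>(1) sat_conj_set[of V "cw (\<sigma>' \<^bold>\<rightarrow> \<tau>')"] conj_set_cw_Arrow by auto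
          then show "\<delta> \<in> cw_core V" using \<delta>(1) by (simp add: cw_core_def del: cw.simps)
        qed
        moreover have "sat (val (G(k := p)) A) \<tau>" using Ap Gp nA by (rule tp_val)
        ultimately have "sat (cw_core V) \<tau>" by (blast intro: sat_mono)
        then have "sat V (cw \<tau>)" by (simp add: sat_cw)
        with \<kappa> have "sat V \<kappa>" using sat_conj_set by blast
        then obtain d where d: "d \<in> disj_set \<kappa>" "d \<in> V" using basic_\<kappa> by (auto simp: sat_basic_union)
        then obtain b where b: "b \<in> B" "G(k := b) \<tturnstile> A \<Ztypecolon> d"
          unfolding V_def Lam by (blast intro: tp.ArrowI)
        have "d \<sqsubseteq> \<kappa>" unfolding entails_def using d(1) sat_disj_set by blast
        with b(2) have "G(k := b) \<tturnstile> A \<Ztypecolon> \<kappa>" by (rule tp_entails)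
        with b(1) show False by (rule contra)
      qed
    qed
  qed
qed

text \<open>\<open>\<sqsubseteq>\<close> treats arrows as atoms, so it cannot vary their domain or
  codomain. That slack is obtained once \<open>P\<close> has become an abstraction and is carried
  back by expansion; it is needed because the families given in the theorem match those of
  \<open>cw\<close> only up to \<open>\<sqsubseteq>\<close>. As \<open>P\<close> is closed, a
  minimal non-captured application in it must be a redex.\<close>

lemma closed_cw:
  assumes "lin P" "\<And>k. occ k P = 0" "P \<Rrightarrow>\<^sup>* Lam N" "nf N" "headed 0 N" "\<And>i. binter (G i)"
    and "G \<tturnstile> P \<Ztypecolon> \<sigma> \<^bold>\<rightarrow> \<tau>" "\<kappa> \<in> conj_set (cw \<tau>)"
  shows "\<exists>\<chi>\<in>conj_set (cw \<sigma>). \<forall>\<chi>' \<kappa>'. \<chi>' \<sqsubseteq> \<chi> \<longrightarrow> \<kappa> \<sqsubseteq> \<kappa>' \<longrightarrow> G \<tturnstile> P \<Ztypecolon> \<chi>' \<^bold>\<rightarrow> \<kappa>'"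
  using assms
proof (induction "size P" arbitrary: P rule: less_induct)
  case less
  show ?case
  proof (cases "nca P")
    case True
    then obtain A0 F K where A0: "occ 0 A0 = 1" "P = inst A0 (App F K)"
      and nF: "\<not> nca F" and nK: "\<not> nca K" by (rule nca_minimal)
    have l: "lin A0" "lin F" "lin K" "\<And>i. occ i F = 0 \<or> occ i K = 0"
      "\<And>i. occ (Suc i) A0 = 0 \<or> occ i (App F K) = 0"
      using less.prems(1) A0 by (simp_all add: lin_inst)
    have closed: "occ i F = 0" for i
      using less.prems(2)[of i] A0 by (simp add: occ_inst)
    show ?thesis
    proof (cases F)
      case (Var z)
      with closed[of z] show ?thesis by simp
    next
      case (App F1 F2)
      with nF show ?thesis by (simp add: nca_App)
    next
      case (Lam L)
      let ?P = "inst A0 (inst L K)"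
      have L: "lin L" "occ 0 L = 1" using l(2) Lam by (simp_all add: lin_Lam)
      have occ: "occ i (inst L K) = occ i (App F K)" for i using L Lam by (simp add: occ_inst)
      have "lin (inst L K)" using l(3,4) L Lam by (simp add: lin_inst)
      then have "lin ?P" using A0(1) l(1,5) by (simp add: lin_inst occ)
      moreover have "P \<Rrightarrow> ?P" unfolding A0(2) Lam by (intro par_inst par.beta) simp_all
      then have "?P \<Rrightarrow>\<^sup>* Lam N" using pars_nf[OF less.prems(3)] less.prems(4) by auto
      moreover have "size ?P < size P" using A0 L Lam by (simp add: size_inst)
      moreover have "occ i ?P = 0" for i
        using less.prems(2)[of i] A0 by (simp add: occ_inst[where M = A0] occ)
      moreover have "G \<tturnstile> ?P \<Ztypecolon> \<sigma> \<^bold>\<rightarrow> \<tau>"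
        by (rule tp_contract) (use less.prems A0 l nF nK Lam in auto)
      ultimately obtain \<chi> where \<chi>: "\<chi> \<in> conj_set (cw \<sigma>)"
        "\<forall>\<chi>' \<kappa>'. \<chi>' \<sqsubseteq> \<chi> \<longrightarrow> \<kappa> \<sqsubseteq> \<kappa>' \<longrightarrow> G \<tturnstile> ?P \<Ztypecolon> \<chi>' \<^bold>\<rightarrow> \<kappa>'"
        using less.hyps[of ?P] less.prems(4-6,8) by blast
      have "G \<tturnstile> P \<Ztypecolon> \<chi>' \<^bold>\<rightarrow> \<kappa>'" if "\<chi>' \<sqsubseteq> \<chi>" "\<kappa> \<sqsubseteq> \<kappa>'" for \<chi>' \<kappa>'
        unfolding A0(2) Lam by (rule tp_expand) (use \<chi>(2) that l(1) A0(1) L in auto)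
      with \<chi>(1) show ?thesis by blast
    qed
  next
    case nP: False
    show ?thesis
    proof (cases P)
      case (Var z)
      with less.prems(2)[of z] show ?thesis by simp
    next
      case (App F K)
      with nP show ?thesis by (simp add: nca_App)
    next
      case (Lam A)
      have "sat (val G P) (\<sigma> \<^bold>\<rightarrow> \<tau>)" using less.prems(7,6) nP by (rule tp_val)
      then have A: "G \<triangleright> \<sigma> \<tturnstile> A \<Ztypecolon> \<tau>" unfolding Lam by simp
      have A_N: "A \<Rrightarrow>\<^sup>* N" using Lam_pars[of A "Lam N"] less.prems(3) Lam by blast
      \<comment> \<open>\<open>G 0\<close> is a placeholder at index \<open>0\<close>, chosen
        because it is a basic intersection.\<close>
      have "\<exists>\<chi>\<in>conj_set (cw \<sigma>). (G \<triangleright> G 0)(0 := \<chi>) \<tturnstile> A \<Ztypecolon> \<kappa>"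
      proof (rule headed_cw[OF _ A_N less.prems(4,5)])
        show "lin A" "occ 0 A = 1" using less.prems(1) Lam by (simp_all add: lin_Lam)
        show "binter ((G \<triangleright> G 0) i)" for i using less.prems(6) by (simp split: nat.split)
        show "(G \<triangleright> G 0)(0 := \<sigma>) \<tturnstile> A \<Ztypecolon> \<tau>" using A by (simp add: case_nat_upd_0)
      qed (fact less.prems(8))
      then obtain \<chi> where \<chi>: "\<chi> \<in> conj_set (cw \<sigma>)" "G \<triangleright> \<chi> \<tturnstile> A \<Ztypecolon> \<kappa>"
        unfolding case_nat_upd_0 by blast
      have "G \<tturnstile> P \<Ztypecolon> \<chi>' \<^bold>\<rightarrow> \<kappa>'" if "\<chi>' \<sqsubseteq> \<chi>" "\<kappa> \<sqsubseteq> \<kappa>'" for \<chi>' \<kappa>'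
        unfolding Lam
      proof (rule tp.ArrowI, rule tp_entails[OF _ that(2)])
        show "G \<triangleright> \<chi>' \<tturnstile> A \<Ztypecolon> \<kappa>"
          using \<chi>(2) by (rule tp_env_mono) (simp add: that(1) split: nat.split)
      qed
      with \<chi>(1) show ?thesis by blast
    qed
  qed
qed

section \<open>Normal forms of finite hereditary permutators\<close>

text \<open>Recursive counterpart of \<open>nca\<close>, with \<open>d\<close> counting the binders
  crossed so far.\<close>

fun nca_under :: "nat \<Rightarrow> trm \<Rightarrow> bool" where
  "nca_under d (Var i) = False"
| "nca_under d (App F K) = ((\<forall>i<d. occ i (App F K) = 0) \<or> nca_under d F \<or> nca_under d K)"
| "nca_under d (Lam M) = nca_under (Suc d) M"

lemma nca_under_hole: "occ d M = 1 \<Longrightarrow> nca_under d (sub (hole d (App F K)) M)"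
proof (induction M arbitrary: d)
  case (Var i)
  then have "i = d" by (simp split: if_splits)
  then show ?case by (simp add: upn_def occ_ren_add_less)
next
  case (App M N)
  then consider "occ d M = 1" | "occ d N = 1" by fastforce
  then show ?case using App.IH by cases auto
next
  case (Lam M)
  then show ?case by (simp add: up_upn)
qed

lemma nca_imp_nca_under: "nca M \<Longrightarrow> nca_under 0 M"
  unfolding nca_def using nca_under_hole[of 0] by auto

lemma nca_under_antimono: "nca_under d M \<Longrightarrow> d' \<le> d \<Longrightarrow> nca_under d' M"
proof (induction M arbitrary: d d')
  case (App M N)
  from App.prems(1) consider "\<forall>i<d. occ i (App M N) = 0" | "nca_under d M" | "nca_under d N" by auto
  then show ?case
  proof cases
    case 1
    then show ?thesis using App.prems(2) by auto
  qed (use App in auto)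
qed auto

lemma nca_under_ren:
  "(\<And>i. i < d \<Longrightarrow> f i = i) \<Longrightarrow> (\<And>i. d \<le> i \<Longrightarrow> d \<le> f i) \<Longrightarrow> nca_under d (ren f M) = nca_under d M"
proof (induction M arbitrary: d f)
  case (App M N)
  have "occ i (ren f L) = occ i L" if "i < d" for i L
  proof -
    have "occ i (Var (f j)) = (if j = i then 1 else 0)" for j
      using App.prems(1)[of j] App.prems(2)[of j] that by (cases "j < d") auto
    from occ_sub1[of i "\<lambda>j. Var (f j)", OF this] show ?thesis by (simp add: ren_sub)
  qed
  then show ?case using App.IH[OF App.prems] by simp
next
  case (Lam M)
  have "nca_under (Suc d) (ren (upr f) M) = nca_under (Suc d) M"
  proof (rule Lam.IH)
    show "upr f i = i" if "i < Suc d" for i using Lam.prems(1) that by (cases i) simp_all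
    show "Suc d \<le> upr f i" if "Suc d \<le> i" for i using Lam.prems(2) that by (cases i) simp_all
  qed
  then show ?case by simp
qed simp

text \<open>By the last conjunct every application in the body uses a variable bound in the body,
  not just \<open>x\<close>. This persists when \<open>x\<close> is renamed, so such bodies can
  serve as arguments of the next head.\<close>

definition hp_body :: "trm \<Rightarrow> bool" where
  "hp_body B \<longleftrightarrow> nf B \<and> headed 0 B \<and> occ 0 B > 0 \<and> (\<forall>k>0. occ k B = 0) \<and> \<not> nca_under 0 B"

section \<open>Conversion as a congruence, and properties of iterated abstractions and
  applications\<close>

lemma beta_ren: "M \<rightarrow>\<^sub>\<beta> N \<Longrightarrow> ren f M \<rightarrow>\<^sub>\<beta> ren f N"
proof (induction arbitrary: f rule: beta.induct)
  case (beta M N)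
  show ?case using beta.beta[of "ren (upr f) M" "ren f N"] by (simp add: subst_inst ren_inst)
qed (auto intro: beta.intros)

lemma conv_map:
  assumes "M =\<^sub>\<beta> N" and "\<And>M N. M \<rightarrow>\<^sub>\<beta> N \<Longrightarrow> f M \<rightarrow>\<^sub>\<beta> f N"
  shows "f M =\<^sub>\<beta> f N"
  using assms(1)
proof (induction rule: equivclp_induct)
  case (step y z)
  then have "f y =\<^sub>\<beta> f z" using assms(2) by (auto intro: r_into_equivclp equivclp_sym)
  with step.IH show ?case by (rule equivclp_trans)
qed simp

lemma conv_App: "M =\<^sub>\<beta> M' \<Longrightarrow> N =\<^sub>\<beta> N' \<Longrightarrow> App M N =\<^sub>\<beta> App M' N'"
  by (rule equivclp_trans[of _ _ "App M' N"])
    (auto intro: conv_map[where f = "\<lambda>M. App M N"] conv_map[where f = "App M'"] beta.intros)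

lemma conv_Lams: "M =\<^sub>\<beta> N \<Longrightarrow> (Lam ^^ n) M =\<^sub>\<beta> (Lam ^^ n) N"
  by (induction n) (auto intro: conv_map[where f = Lam] beta.lam)

lemma conv_lifts: "M =\<^sub>\<beta> N \<Longrightarrow> ((\<lambda>M. lift M 0) ^^ n) M =\<^sub>\<beta> ((\<lambda>M. lift M 0) ^^ n) N"
  by (induction n) (auto intro: conv_map[where f = "ren Suc"] simp: lift_0 beta_ren)

lemma conv_foldl:
  "M =\<^sub>\<beta> N \<Longrightarrow> (\<And>i. i \<in> set is \<Longrightarrow> f i =\<^sub>\<beta> g i) \<Longrightarrow>
    foldl App M (map f is) =\<^sub>\<beta> foldl App N (map g is)"
  by (induction "is" arbitrary: M N) (simp_all add: conv_App)

lemma occ_foldl: "occ k (foldl App M Ns) = occ k M + sum_list (map (occ k) Ns)"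
  by (induction Ns arbitrary: M) simp_all

lemma occ_Lams: "occ k ((Lam ^^ n) M) = occ (k + n) M"
  by (induction n arbitrary: k) simp_all

lemma nf_Lams: "nf ((Lam ^^ n) M) = nf M"
  by (induction n) simp_all

lemma headed_Lams: "headed k ((Lam ^^ n) M) = headed (k + n) M"
  by (induction n arbitrary: k) simp_all

lemma nca_under_Lams: "nca_under d ((Lam ^^ n) M) = nca_under (d + n) M"
  by (induction n arbitrary: d) simp_all

lemma nf_foldl: "(\<And>N. N \<in> set Ns \<Longrightarrow> nf N) \<Longrightarrow> nf (foldl App (Var k) Ns)"
proof (induction Ns rule: rev_induct)
  case (snoc N Ns)
  have "nf (foldl App (Var k) Ns)" by (rule snoc.IH) (simp add: snoc.prems)
  then show ?case using snoc.prems by (cases Ns rule: rev_cases) simp_all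
qed simp

lemma spine_foldl: "spine k (foldl App (Var k) Ns) \<longleftrightarrow> (\<forall>N\<in>set Ns. \<not> nca N)"
  by (induction Ns rule: rev_induct) auto

lemma nca_under_foldl:
  "(\<And>N. N \<in> set Ns \<Longrightarrow> \<not> nca_under d N \<and> (\<exists>i<d. occ i N > 0)) \<Longrightarrow> \<not> nca_under d (foldl App (Var k) Ns)"
  by (induction Ns rule: rev_induct) auto

text \<open>Each argument \<open>P\<^sub>i y\<close> converts to the body of
  \<open>P\<^sub>i\<close> with \<open>x\<close> renamed to \<open>y\<close>. So it mentions exactly
  one of the outer bound variables, and the applications of the head to it are captured.\<close>

lemma fhp_nf: "fhp P \<Longrightarrow> \<exists>B. P =\<^sub>\<beta> Lam B \<and> hp_body B"
proof (induction rule: fhp.induct)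
  case (1 \<pi> n Ps P)
  then have "\<forall>i. \<exists>B. i < n \<longrightarrow> Ps i =\<^sub>\<beta> Lam B \<and> hp_body B" by blast
  then obtain Bs where Bs: "\<And>i. i < n \<Longrightarrow> Ps i =\<^sub>\<beta> Lam (Bs i)" "\<And>i. i < n \<Longrightarrow> hp_body (Bs i)"
    by metis
  define v where "v i = n - 1 - \<pi> i" for i
  have v: "v i < n" if "i < n" for i using that by (simp add: v_def)
  define K where "K i = inst (Bs i) (Var (v i))" for i
  have K_ren: "K i = ren (case_nat (v i) id) (Bs i)" for i
    unfolding K_def ren_sub by (rule sub_cong) (simp split: nat.split)
  define X where "X = foldl App (Var n) (map K [0..<n])"
  have Ps: "App (((\<lambda>M. lift M 0) ^^ Suc n) (Ps i)) (Var (v i)) =\<^sub>\<beta> K i" if "i < n" for i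
  proof -
    \<comment> \<open>The body of \<open>Lam (Bs i)\<close> has only index \<open>0\<close> free, so
      lifting fixes this form of \<open>Ps i\<close>; conversion carries this through the lifts of
      \<open>Ps i\<close>.\<close>
    have closed: "ren Suc (Lam (Bs i)) = Lam (Bs i)"
      by (rule ren_id) (use Bs(2)[OF that] in \<open>auto simp: hp_body_def\<close>)
    have "((\<lambda>M. lift M 0) ^^ m) (Lam (Bs i)) = Lam (Bs i)" for m
      by (induction m) (simp_all only: funpow.simps o_apply id_apply lift_0 closed)
    then have "((\<lambda>M. lift M 0) ^^ Suc n) (Ps i) =\<^sub>\<beta> Lam (Bs i)"
      using conv_lifts[OF Bs(1)[OF that], of "Suc n"] by metis
    then have "App (((\<lambda>M. lift M 0) ^^ Suc n) (Ps i)) (Var (v i)) =\<^sub>\<beta> App (Lam (Bs i)) (Var (v i))"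
      by (rule conv_App) simp
    moreover have "App (Lam (Bs i)) (Var (v i)) =\<^sub>\<beta> K i"
      using beta.beta[of "Bs i" "Var (v i)"] by (simp add: subst_inst K_def r_into_equivclp)
    ultimately show ?thesis by (rule equivclp_trans)
  qed
  have "P =\<^sub>\<beta> (Lam ^^ Suc n) X"
    using "1.hyps"(3) unfolding X_def
    by (rule equivclp_trans) (intro conv_Lams conv_foldl, simp, use Ps in \<open>simp add: v_def\<close>)
  then have "P =\<^sub>\<beta> Lam ((Lam ^^ n) X)" by simp
  moreover have "hp_body ((Lam ^^ n) X)"
  proof -
    have occ_K: "occ j (K i) > 0 \<longleftrightarrow> j = v i" if "i < n" for i j
      using Bs(2)[OF that] by (auto simp: K_def occ_inst hp_body_def)
    have nf_K: "nf (K i)" if "i < n" for i using Bs(2)[OF that] by (simp add: K_ren hp_body_def)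
    have nca_under_K: "\<not> nca_under d (K i)" if "i < n" for i d
      using Bs(2)[OF that] nca_under_antimono[of d "K i" 0] by (auto simp: K_ren nca_under_ren hp_body_def)
    have "nf X" unfolding X_def by (rule nf_foldl) (auto simp: nf_K)
    moreover have "spine n X" unfolding X_def spine_foldl using nca_under_K nca_imp_nca_under by fastforce
    moreover have "occ j (K i) = 0" if "i < n" "n \<le> j" for i j
      using occ_K[OF that(1), of j] v[OF that(1)] that(2) by auto
    then have "occ j X = (if j = n then 1 else 0)" if "n \<le> j" for j
      unfolding X_def occ_foldl using that by (auto intro!: sum_list_0)
    moreover have "\<not> nca_under n X"
      unfolding X_def by (rule nca_under_foldl) (use nca_under_K occ_K v in force)
    ultimately show ?thesis
      by (simp add: hp_body_def nf_Lams headed_Lams occ_Lams nca_under_Lams spine_headed)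
  qed
  ultimately show ?case by blast
qed

section \<open>Comparison of the two type assignment systems\<close>

definition agrees :: "'a env \<Rightarrow> (nat \<Rightarrow> 'a ty) \<Rightarrow> bool" where
  "agrees \<Gamma> G \<longleftrightarrow> (\<forall>k \<sigma>. \<Gamma> k = Some \<sigma> \<longrightarrow> G k = \<sigma>)"

lemma agrees_extend: "agrees \<Gamma> G \<Longrightarrow> agrees (\<Gamma> \<lhd> \<sigma>) (G \<triangleright> \<sigma>)"
  unfolding agrees_def env_extend_def by (simp split: nat.split)

lemma agrees_addD:
  assumes "agrees (\<Gamma>1 ++ \<Gamma>2) G" and "dom \<Gamma>1 \<inter> dom \<Gamma>2 = {}"
  shows "agrees \<Gamma>1 G" "agrees \<Gamma>2 G"
proof -
  have "(\<Gamma>1 ++ \<Gamma>2) k = Some \<sigma>" if "\<Gamma>1 k = Some \<sigma> \<or> \<Gamma>2 k = Some \<sigma>" for k \<sigma>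
    using that
  proof
    assume 1: "\<Gamma>1 k = Some \<sigma>"
    then have "k \<notin> dom \<Gamma>2" using assms(2) by blast
    with 1 show ?thesis by (simp add: map_add_dom_app_simps(3))
  qed simp
  with assms(1) show "agrees \<Gamma>1 G" "agrees \<Gamma>2 G" unfolding agrees_def by blast+
qed

text \<open>The domain of the environment determines the occurrence counts, and these provide the
  condition \<open>occ 0 M = 1\<close> in the translation of union elimination.\<close>

lemma typing_tp: "\<Gamma> \<turnstile> M \<Ztypecolon> \<tau> \<Longrightarrow> agrees \<Gamma> G \<Longrightarrow> G \<tturnstile> M \<Ztypecolon> \<tau>"
  and typing_blin: "\<Gamma> \<turnstile> M \<Ztypecolon> \<tau> \<Longrightarrow> blin M"
  and typing_occ: "\<Gamma> \<turnstile> M \<Ztypecolon> \<tau> \<Longrightarrow> occ k M = (if k \<in> dom \<Gamma> then 1 else 0)"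
proof -
  have blin_occ: "blin M \<and> (\<forall>k. occ k M = (if k \<in> dom \<Gamma> then 1 else 0))" if "\<Gamma> \<turnstile> M \<Ztypecolon> \<tau>"
    for \<Gamma> :: "'a env" and M \<tau>
    using that
  proof (induction rule: typing.induct)
    case (ArrowI \<Gamma> \<sigma> M \<tau>)
    then have M: "blin M" "\<And>k. occ k M = (if k \<in> dom (\<Gamma> \<lhd> \<sigma>) then 1 else 0)" by simp_all
    show ?case using M(1) M(2)[of 0] M(2)[of "Suc k" for k] by (simp add: env_extend_def domIff)
  next
    case (ArrowE \<Gamma>1 M \<sigma> \<tau> \<Gamma>2 N)
    then have "k \<notin> dom \<Gamma>1 \<or> k \<notin> dom \<Gamma>2" for k by blast
    with ArrowE.IH show ?case by simp
  next
    case (UnionE \<Gamma>1 \<sigma> \<theta> M \<rho> \<tau> \<Gamma>2 N)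
    have "occ 0 M = 1" "\<And>k. occ (Suc k) M = (if k \<in> dom \<Gamma>1 then 1 else 0)"
      using UnionE.IH(1) by (simp_all add: env_extend_def domIff)
    moreover have "k \<notin> dom \<Gamma>1 \<or> k \<notin> dom \<Gamma>2" for k using UnionE.hyps(4) by blast
    ultimately show ?case using UnionE.IH by (simp add: subst_inst occ_inst blin_inst)
  qed (simp_all add: dom_def)
  then show "\<Gamma> \<turnstile> M \<Ztypecolon> \<tau> \<Longrightarrow> blin M" "\<Gamma> \<turnstile> M \<Ztypecolon> \<tau> \<Longrightarrow> occ k M = (if k \<in> dom \<Gamma> then 1 else 0)"
    by blast+
  show "\<Gamma> \<turnstile> M \<Ztypecolon> \<tau> \<Longrightarrow> agrees \<Gamma> G \<Longrightarrow> G \<tturnstile> M \<Ztypecolon> \<tau>"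
  proof (induction arbitrary: G rule: typing.induct)
    case (Ax k \<sigma>)
    then show ?case by (simp add: tp_Var_iff agrees_def)
  next
    case (ArrowI \<Gamma> \<sigma> M \<tau>)
    from ArrowI.IH[OF agrees_extend[OF ArrowI.prems]] show ?case by (rule tp.ArrowI)
  next
    case (ArrowE \<Gamma>1 M \<sigma> \<tau> \<Gamma>2 N)
    note G = agrees_addD[OF ArrowE.prems ArrowE.hyps(3)]
    from ArrowE.IH(1)[OF G(1)] ArrowE.IH(2)[OF G(2)] show ?case by (rule tp.ArrowE)
  next
    case (UnionE \<Gamma>1 \<sigma> \<theta> M \<rho> \<tau> \<Gamma>2 N)
    note G = agrees_addD[OF UnionE.prems UnionE.hyps(4)]
    have "occ 0 M = 1" using blin_occ[OF UnionE.hyps(1)] by (simp add: env_extend_def domIff)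
    with UnionE.IH(1)[OF agrees_extend[OF G(1)]] UnionE.IH(2)[OF agrees_extend[OF G(1)]]
      UnionE.IH(3)[OF G(2)]
    show ?case unfolding subst_inst by (rule tp.UnionE)
  qed (auto intro: tp.intros)
qed

text \<open>Restricting \<open>G\<close> to the free variables of each subterm recovers the split
  environments; linearity makes their domains disjoint.\<close>

lemma tp_typing:
  "G \<tturnstile> M \<Ztypecolon> \<tau> \<Longrightarrow> lin M \<Longrightarrow> (\<lambda>k. if occ k M > 0 then Some (G k) else None) \<turnstile> M \<Ztypecolon> \<tau>"
proof (induction rule: tp.induct)
  case (Ax G k)
  have "(\<lambda>j. if occ j (Var k) > 0 then Some (G j) else None) = [k \<mapsto> G k]" by (rule ext) simp
  then show ?case using typing.Ax by metis
next
  case (ArrowI G \<sigma> M \<tau>)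
  let ?E = "\<lambda>k. if occ k (Lam M) > 0 then Some (G k) else None"
  have "lin M" "occ 0 M = 1" using ArrowI.prems by (simp_all add: lin_Lam)
  then have "(\<lambda>k. if occ k M > 0 then Some ((G \<triangleright> \<sigma>) k) else None) = ?E \<lhd> \<sigma>"
    by (intro ext) (auto simp: env_extend_def split: nat.split)
  with ArrowI.IH \<open>lin M\<close> show ?case by (metis typing.ArrowI)
next
  case (ArrowE G M \<sigma> \<tau> N)
  let ?E = "\<lambda>M k. if occ k M > 0 then Some (G k) else None"
  have l: "lin M" "lin N" "\<And>k. occ k M = 0 \<or> occ k N = 0" using ArrowE.prems by simp_all
  have "?E (App M N) = ?E M ++ ?E N" by (rule ext) (simp add: map_add_def)
  moreover have "dom (?E M) \<inter> dom (?E N) = {}" using l(3) by (auto simp: dom_def) (metis less_irrefl)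
  ultimately show ?case using typing.ArrowE[OF ArrowE.IH(1)[OF l(1)] ArrowE.IH(2)[OF l(2)]] by simp
next
  case (UnionE G \<sigma> \<theta> M \<rho> \<tau> N)
  let ?E = "\<lambda>M k. if occ k M > 0 then Some (G k) else None"
  let ?E1 = "\<lambda>k. if occ (Suc k) M > 0 then Some (G k) else None"
  have l: "lin M" "lin N" "\<And>k. occ (Suc k) M = 0 \<or> occ k N = 0"
    using UnionE.prems UnionE.hyps(4) by (simp_all add: lin_inst)
  have "(\<lambda>k. if occ k M > 0 then Some ((G \<triangleright> \<alpha>) k) else None) = ?E1 \<lhd> \<alpha>" for \<alpha>
    by (rule ext) (use UnionE.hyps(4) in \<open>auto simp: env_extend_def split: nat.split\<close>)
  with UnionE.IH(1,2) l(1) have "?E1 \<lhd> \<sigma> \<^bold>\<and> \<theta> \<turnstile> M \<Ztypecolon> \<rho>" "?E1 \<lhd> \<tau> \<^bold>\<and> \<theta> \<turnstile> M \<Ztypecolon> \<rho>" by metis+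
  moreover have "dom ?E1 \<inter> dom (?E N) = {}" using l(3) by (auto simp: dom_def) (metis less_irrefl)
  ultimately have "?E1 ++ ?E N \<turnstile> subst M N 0 \<Ztypecolon> \<rho>" using UnionE.IH(3)[OF l(2)] by (blast intro: typing.UnionE)
  moreover have "?E (inst M N) = ?E1 ++ ?E N"
    by (rule ext) (simp add: map_add_def occ_inst UnionE.hyps(4))
  ultimately show ?case by (simp add: subst_inst)
qed (auto intro: typing.intros)

theorem mainTheorem5:
  fixes P :: trm and \<sigma> \<tau> :: "'a ty" and \<chi> \<kappa> :: "'a ty list"
  assumes "fhp P"
    and "\<chi> \<noteq> []" and "\<forall>i<length \<chi>. basic_union (\<chi> ! i)" and "cw \<sigma> \<simeq> Inters \<chi>"
    and "\<kappa> \<noteq> []" and "\<forall>j<length \<kappa>. basic_union (\<kappa> ! j)" and "cw \<tau> \<simeq> Inters \<kappa>"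
    and "Map.empty \<turnstile> P \<Ztypecolon> \<sigma> \<^bold>\<rightarrow> \<tau>"
  shows "\<forall>j<length \<kappa>. \<exists>i<length \<chi>. Map.empty \<turnstile> P \<Ztypecolon> \<chi> ! i \<^bold>\<rightarrow> \<kappa> ! j"
proof (intro allI impI)
  fix j assume j: "j < length \<kappa>"
  \<comment> \<open>\<open>P\<close> is closed, so any environment of basic intersections will
    do.\<close>
  let ?G = "\<lambda>_. Atom undefined :: 'a ty"
  have P: "lin P" "\<And>k. occ k P = 0" "?G \<tturnstile> P \<Ztypecolon> \<sigma> \<^bold>\<rightarrow> \<tau>"
    using typing_tp[OF assms(8), of ?G] typing_blin[OF assms(8)] typing_occ[OF assms(8)]
    by (simp_all add: lin_def agrees_def)
  obtain B where B: "P =\<^sub>\<beta> Lam B" "hp_body B" using fhp_nf[OF assms(1)] by blast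
  then have N: "P \<Rrightarrow>\<^sup>* Lam B" "nf B" "headed 0 B" using conv_nf[of P "Lam B"] by (simp_all add: hp_body_def)
  \<comment> \<open>The given families match those of \<open>cw\<close> only through
    \<open>\<simeq>\<close>, so they are compared by valuations: each \<open>\<kappa> ! j\<close>
    lies above some component of \<open>cw \<tau>\<close>.\<close>
  have "Inters (conjuncts (cw \<tau>)) \<sqsubseteq> \<kappa> ! j"
    using aci_sat[OF assms(7)] sat_Inters[OF assms(5)] j nth_mem[OF j]
    by (simp add: entails_def sat_Inters flip: sat_conj_set)
  then obtain \<kappa>' where \<kappa>': "\<kappa>' \<in> conj_set (cw \<tau>)" "\<kappa>' \<sqsubseteq> \<kappa> ! j"
    using Inters_entails_basic_union[of "\<kappa> ! j" "conjuncts (cw \<tau>)"] assms(6) j by auto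
  obtain \<chi>' where \<chi>': "\<chi>' \<in> conj_set (cw \<sigma>)"
    "\<forall>\<chi> \<kappa>. \<chi> \<sqsubseteq> \<chi>' \<longrightarrow> \<kappa>' \<sqsubseteq> \<kappa> \<longrightarrow> ?G \<tturnstile> P \<Ztypecolon> \<chi> \<^bold>\<rightarrow> \<kappa>"
    using closed_cw[OF P(1,2) N _ P(3) \<kappa>'(1)] by auto
  \<comment> \<open>The dual comparison: the component found for \<open>cw \<sigma>\<close> lies
    above some member of the given family.\<close>
  have "Inters \<chi> \<sqsubseteq> \<chi>'"
    using aci_sat[OF assms(4)] \<chi>'(1) sat_conj_set[of _ "cw \<sigma>"] by (auto simp: entails_def)
  then obtain \<alpha> where "\<alpha> \<in> set \<chi>" "\<alpha> \<sqsubseteq> \<chi>'"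
    using Inters_entails_basic_union[of \<chi>' \<chi>] cw_basic_union[OF \<chi>'(1)] assms(2) by blast
  then obtain i where i: "i < length \<chi>" "\<chi> ! i \<sqsubseteq> \<chi>'" by (auto simp: in_set_conv_nth)
  then have "?G \<tturnstile> P \<Ztypecolon> \<chi> ! i \<^bold>\<rightarrow> \<kappa> ! j" using \<chi>'(2) \<kappa>'(2) by blast
  from tp_typing[OF this P(1)] have "Map.empty \<turnstile> P \<Ztypecolon> \<chi> ! i \<^bold>\<rightarrow> \<kappa> ! j"
    using P(2) by simp
  with i(1) show "\<exists>i<length \<chi>. Map.empty \<turnstile> P \<Ztypecolon> \<chi> ! i \<^bold>\<rightarrow> \<kappa> ! j" by blast
qed

end
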